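(* Let $f\in L^\infty(\mathbb{C})$ and $j\in\mathbb{N}_0$. Then $T_f^{(j)}$ is compact if and only if its Berezin transform satisfies $\widetilde{T_f^{(j)}}\in C_0(\mathbb{C})$.
   Context: $\mu$ is the Gaussian measure $d\mu(z)=\frac1\pi e^{-|z|^2}dz$ on $\mathbb{C}$, and $F^2=L^2(\mathbb{C},\mu)\cap\operatorname{Hol}(\mathbb{C})$ is the Fock space with inner product $\langle f,g\rangle=\int f\overline g\,d\mu$ and orthonormal basis $e_n(z)=z^n/\sqrt{n!}$, $n\in\mathbb{N}_0$. The normalized reproducing kernels are $k_z(w)=e^{w\overline z-|z|^2/2}$, and the Berezin transform of $A\in\mathcal{L}(F^2)$ is $\widetilde A(z)=\langle Ak_z,k_z\rangle$. $C_0(\mathbb{C})$ is the space of continuous functions vanishing at infinity. For $z\in\mathbb{C}$ let $U_z$ be the bounded self-adjoint operator on $F^2$ given by $U_zf(w)=f(z-w)k_z(w)$. For $f\in L^\infty(\mathbb{C})$ and $j\in\mathbb{N}_0$ the Toeplitz-type operator $T_f^{(j)}$ is the bounded operator on $F^2$ defined weakly by $$\langle T_f^{(j)}g,h\rangle=\frac1\pi\int_{\mathbb{C}}f(z)\langle U_zg,e_j\rangle\langle e_j,U_zh\rangle\,dz,\qquad g,h\in F^2.$$ *)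

theory Defs
  imports "HOL-Analysis.Analysis"
begin

definition gauss :: "complex measure" where
  "gauss = density lborel (\<lambda>z. ennreal (exp (- (cmod z)\<^sup>2) / pi))"

text \<open>Elements are honest functions: an entire function is determined by its
  almost-everywhere class, so no quotient is needed (see \<open>Metric_space_fock\<close>).\<close>

definition fock :: "(complex \<Rightarrow> complex) set" where
  "fock = {f. f holomorphic_on UNIV \<and> integrable gauss (\<lambda>z. (cmod (f z))\<^sup>2)}"

definition fock_inner :: "(complex \<Rightarrow> complex) \<Rightarrow> (complex \<Rightarrow> complex) \<Rightarrow> complex" where
  "fock_inner f g = (LINT z|gauss. f z * cnj (g z))"

definition fock_norm :: "(complex \<Rightarrow> complex) \<Rightarrow> real" where
  "fock_norm f = sqrt (Re (fock_inner f f))"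

definition fock_dist :: "(complex \<Rightarrow> complex) \<Rightarrow> (complex \<Rightarrow> complex) \<Rightarrow> real" where
  "fock_dist f g = fock_norm (\<lambda>z. f z - g z)"

definition fock_basis :: "nat \<Rightarrow> complex \<Rightarrow> complex" where
  "fock_basis n z = z ^ n / complex_of_real (sqrt (fact n))"

definition fock_kernel :: "complex \<Rightarrow> complex \<Rightarrow> complex" where
  "fock_kernel z w = exp (w * cnj z - complex_of_real ((cmod z)\<^sup>2 / 2))"

text \<open>An operator on \<^term>\<open>fock\<close> is a map on functions of which only the restriction to
  \<^term>\<open>fock\<close> matters.\<close>

definition fock_linear :: "((complex \<Rightarrow> complex) \<Rightarrow> (complex \<Rightarrow> complex)) \<Rightarrow> bool" where
  "fock_linear T \<longleftrightarrow>
     (\<forall>g\<in>fock. T g \<in> fock) \<and>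
     (\<forall>g\<in>fock. \<forall>h\<in>fock. T (\<lambda>w. g w + h w) = (\<lambda>w. T g w + T h w)) \<and>
     (\<forall>c. \<forall>g\<in>fock. T (\<lambda>w. c * g w) = (\<lambda>w. c * T g w))"

definition fock_compact_operator :: "((complex \<Rightarrow> complex) \<Rightarrow> (complex \<Rightarrow> complex)) \<Rightarrow> bool" where
  "fock_compact_operator T \<longleftrightarrow> fock_linear T \<and>
     (let X = Metric_space.mtopology fock fock_dist
      in compactin X (X closure_of (T ` {g \<in> fock. fock_norm g \<le> 1})))"

definition berezin :: "((complex \<Rightarrow> complex) \<Rightarrow> (complex \<Rightarrow> complex)) \<Rightarrow> complex \<Rightarrow> complex" where
  "berezin A z = fock_inner (A (fock_kernel z)) (fock_kernel z)"

definition fock_U :: "complex \<Rightarrow> (complex \<Rightarrow> complex) \<Rightarrow> (complex \<Rightarrow> complex)" where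
  "fock_U z g = (\<lambda>w. g (z - w) * fock_kernel z w)"

text \<open>The weak definition is resolved separately for each \<open>g \<in> fock\<close>: as an operator is arbitrary
  outside \<^term>\<open>fock\<close>, a definite description of the whole map would not be unique.\<close>

definition toeplitz ::
  "(complex \<Rightarrow> complex) \<Rightarrow> nat \<Rightarrow> (complex \<Rightarrow> complex) \<Rightarrow> (complex \<Rightarrow> complex)" where
  "toeplitz f j g = (THE u. u \<in> fock \<and>
     (\<forall>h\<in>fock. fock_inner u h = 1 / complex_of_real pi *
        (LINT z|lebesgue. f z * fock_inner (fock_U z g) (fock_basis j)
                              * fock_inner (fock_basis j) (fock_U z h))))"

definition Linfty :: "(complex \<Rightarrow> complex) set" where
  "Linfty = {f. f \<in> borel_measurable lebesgue \<and> (\<exists>C. AE z in lebesgue. cmod (f z) \<le> C)}"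

definition C0 :: "(complex \<Rightarrow> complex) set" where
  "C0 = {F. continuous_on UNIV F \<and> (F \<longlongrightarrow> 0) at_infinity}"

lemma fock_measurable:
  assumes "f \<in> fock"
  shows "f \<in> borel_measurable borel"
  using assms
  by (auto simp: fock_def intro!: borel_measurable_continuous_onI holomorphic_on_imp_continuous_on)

lemma sets_gauss [simp, measurable_cong]: "sets gauss = sets borel"
  by (simp add: gauss_def)

lemma fock_norm_eq: "fock_norm f = sqrt (LINT z|gauss. (cmod (f z))\<^sup>2)"
proof -
  have "fock_inner f f = (LINT z|gauss. complex_of_real ((cmod (f z))\<^sup>2))"
    unfolding fock_inner_def by (simp add: complex_norm_square del: of_real_power)
  also have "\<dots> = complex_of_real (LINT z|gauss. (cmod (f z))\<^sup>2)"
    by (rule integral_complex_of_real)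
  finally show ?thesis
    by (simp add: fock_norm_def)
qed

lemma fock_norm_nonneg: "0 \<le> fock_norm f"
  by (simp add: fock_norm_eq)

lemma fock_norm_power2: "(fock_norm f)\<^sup>2 = (LINT z|gauss. (cmod (f z))\<^sup>2)"
  by (simp add: fock_norm_eq)

lemma cmod_add_square_le:
  assumes "t > 0"
  shows "(cmod (a + b))\<^sup>2 \<le> (1 + t) * (cmod a)\<^sup>2 + (1 + 1 / t) * (cmod b)\<^sup>2"
proof -
  have "(cmod (a + b))\<^sup>2 \<le> (cmod a + cmod b)\<^sup>2"
    by (intro power_mono norm_triangle_ineq) auto
  also have "\<dots> = (cmod a)\<^sup>2 + (cmod b)\<^sup>2 + 2 * (cmod a * cmod b)"
    by (simp add: power2_eq_square algebra_simps)
  also have "2 * (cmod a * cmod b) \<le> t * (cmod a)\<^sup>2 + (cmod b)\<^sup>2 / t"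
  proof -
    have "0 \<le> (t * cmod a - cmod b)\<^sup>2 / t"
      using assms by simp
    also have "\<dots> = t * (cmod a)\<^sup>2 + (cmod b)\<^sup>2 / t - 2 * (cmod a * cmod b)"
      using assms by (simp add: power2_eq_square field_simps)
    finally show ?thesis by simp
  qed
  finally show ?thesis
    by (simp add: algebra_simps)
qed

lemma fock_add:
  assumes f: "f \<in> fock" and g: "g \<in> fock"
  shows "(\<lambda>z. f z + g z) \<in> fock"
proof -
  have [measurable]: "f \<in> borel_measurable borel" "g \<in> borel_measurable borel"
    using assms fock_measurable by auto
  have "integrable gauss (\<lambda>z. (1 + 1) * (cmod (f z))\<^sup>2 + (1 + 1 / 1) * (cmod (g z))\<^sup>2)"
    using f g by (auto simp: fock_def)
  then have "integrable gauss (\<lambda>z. (cmod (f z + g z))\<^sup>2)"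
  proof (rule Bochner_Integration.integrable_bound)
    show "AE z in gauss. norm ((cmod (f z + g z))\<^sup>2)
        \<le> norm ((1 + 1) * (cmod (f z))\<^sup>2 + (1 + 1 / 1) * (cmod (g z))\<^sup>2)"
    proof (rule AE_I2)
      fix z
      show "norm ((cmod (f z + g z))\<^sup>2)
        \<le> norm ((1 + 1) * (cmod (f z))\<^sup>2 + (1 + 1 / 1) * (cmod (g z))\<^sup>2)"
        using cmod_add_square_le[of 1 "f z" "g z"] by (auto simp: abs_if)
    qed
  qed measurable
  then show ?thesis
    using f g by (auto simp: fock_def intro: holomorphic_intros)
qed

lemma fock_cmult:
  assumes "f \<in> fock"
  shows "(\<lambda>z. c * f z) \<in> fock"
  using assms by (auto simp: fock_def norm_mult power_mult_distrib intro: holomorphic_intros)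

lemma fock_diff:
  assumes "f \<in> fock" "g \<in> fock"
  shows "(\<lambda>z. f z - g z) \<in> fock"
  using fock_add[OF assms(1) fock_cmult[OF assms(2), of "-1"]] by simp

lemma fock_norm_triangle:
  assumes f: "f \<in> fock" and g: "g \<in> fock"
  shows "fock_norm (\<lambda>z. f z + g z) \<le> fock_norm f + fock_norm g"
proof (rule field_le_epsilon)
  fix e :: real assume e: "e > 0"
  define a where "a = fock_norm f + e / 2"
  define b where "b = fock_norm g + e / 2"
  have ab: "a > 0" "b > 0" "(fock_norm f)\<^sup>2 \<le> a\<^sup>2" "(fock_norm g)\<^sup>2 \<le> b\<^sup>2"
    using e fock_norm_nonneg[of f] fock_norm_nonneg[of g]
    by (auto simp: a_def b_def intro!: power_mono)
  have int: "integrable gauss (\<lambda>z. (cmod (f z))\<^sup>2)" "integrable gauss (\<lambda>z. (cmod (g z))\<^sup>2)"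
    "integrable gauss (\<lambda>z. (cmod (f z + g z))\<^sup>2)"
    using f g fock_add[OF f g] by (auto simp: fock_def)
  have "(fock_norm (\<lambda>z. f z + g z))\<^sup>2
      \<le> (LINT z|gauss. (1 + b / a) * (cmod (f z))\<^sup>2 + (1 + 1 / (b / a)) * (cmod (g z))\<^sup>2)"
    unfolding fock_norm_power2 using int ab(1,2)
    by (intro integral_mono cmod_add_square_le) auto
  also have "\<dots> = (1 + b / a) * (fock_norm f)\<^sup>2 + (1 + 1 / (b / a)) * (fock_norm g)\<^sup>2"
    using int by (simp add: fock_norm_power2)
  also have "\<dots> \<le> (1 + b / a) * a\<^sup>2 + (1 + 1 / (b / a)) * b\<^sup>2"
    using ab by (intro add_mono mult_left_mono) auto
  also have "\<dots> = (a + b)\<^sup>2"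
    using ab by (simp add: power2_eq_square field_simps)
  finally have "fock_norm (\<lambda>z. f z + g z) \<le> a + b"
    using ab by (meson add_nonneg_nonneg less_imp_le power2_le_imp_le)
  then show "fock_norm (\<lambda>z. f z + g z) \<le> fock_norm f + fock_norm g + e"
    by (simp add: a_def b_def)
qed

lemma fock_norm_eq_0_imp:
  assumes f: "f \<in> fock" and 0: "fock_norm f = 0"
  shows "f = (\<lambda>z. 0)"
proof -
  have [measurable]: "f \<in> borel_measurable borel"
    using f fock_measurable by auto
  have "integrable gauss (\<lambda>z. (cmod (f z))\<^sup>2)"
    using f by (auto simp: fock_def)
  then have "AE z in gauss. (cmod (f z))\<^sup>2 = 0"
    using 0 by (subst (asm) fock_norm_eq) (simp add: integral_nonneg_eq_0_iff_AE)
  then have "AE z in lborel. f z = 0"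
    unfolding gauss_def by (subst (asm) AE_density) auto
  then have "AE z in lebesgue. f z = 0"
    by (rule AE_completion)
  then have ae: "AE z in lebesgue. z \<in> UNIV \<longrightarrow> z \<in> f -` {0}"
    by simp
  have "closed (f -` {0})"
    using f by (intro closed_vimage)
      (auto simp: fock_def intro: holomorphic_on_imp_continuous_on)
  then have "z \<in> f -` {0}" for z
    using mem_closed_if_AE_lebesgue_open[of UNIV "f -` {0}" z] ae by auto
  then show ?thesis by auto
qed

theorem Metric_space_fock: "Metric_space fock fock_dist"
proof
  fix f g
  show "0 \<le> fock_dist f g"
    by (simp add: fock_dist_def fock_norm_nonneg)
  show "fock_dist f g = fock_dist g f"
    by (simp add: fock_dist_def fock_norm_eq norm_minus_commute)
next
  fix f g assume fg: "f \<in> fock" "g \<in> fock"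
  show "fock_dist f g = 0 \<longleftrightarrow> f = g"
  proof
    assume "fock_dist f g = 0"
    then have "(\<lambda>z. f z - g z) = (\<lambda>z. 0)"
      using fock_norm_eq_0_imp[OF fock_diff[OF fg]] by (simp add: fock_dist_def)
    then show "f = g"
      by (simp add: fun_eq_iff)
  qed (simp add: fock_dist_def fock_norm_eq)
next
  fix f g h assume "f \<in> fock" "g \<in> fock" "h \<in> fock"
  then have "fock_norm (\<lambda>z. (f z - g z) + (g z - h z)) \<le> fock_dist f g + fock_dist g h"
    unfolding fock_dist_def by (intro fock_norm_triangle fock_diff)
  then show "fock_dist f h \<le> fock_dist f g + fock_dist g h"
    by (simp add: fock_dist_def)
qed

end

(* Write E_z = U_z e_j. The operator is T g = (1/pi) int f(z) <g, E_z> E_z dz, an integral operator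
   whose weighted kernel t(w, u) = (1/pi) int f(z) E_z(w) cnj (E_z(u)) dz is dominated by a
   convolution kernel in L^1. By a Schur test,
     ||T g||^2 <= c * int s(u) |g(u)|^2 dmu(u),  where s(u) = int |t(w, u)| dw (weights omitted).
   Translating by u, the entry t(u + b, u) is, up to explicit factors, the value at s = -i of an entire
   function of s that is bounded on discs uniformly in u, and whose values at real s are values of the
   Berezin transform of T near u. So if the Berezin transform vanishes at infinity, then by Vitali's
   theorem t(u + b, u) -> 0 for every b, and by dominated convergence s(u) -> 0 as |u| -> infinity.
   A bounded sequence in the Fock space has a pointwise convergent subsequence, by Montel's theorem, and
   the estimate turns this into norm convergence of the images. Conversely, the normalized
   kernels tend to 0 weakly at infinity, so a compact T maps them to a null family in norm. *)
theory Submission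
  imports Defs "HOL-Complex_Analysis.Complex_Analysis"
begin

section \<open>Gaussian measure and the mean value property\<close>

text \<open>A vanishing Berezin transform does not make a general bounded operator compact:
  \<open>fock_U 0\<close> sends \<open>g\<close> to \<open>w \<mapsto> g (- w)\<close>, is
  isometric, and has Berezin transform \<open>exp (- 2 * (cmod z)^2)\<close>. Its kernel sits at
  \<open>w = - u\<close>, far from the diagonal. The majorant depending on \<open>w - u\<close>
  alone rules this out, so that the entries at each fixed offset \<open>b\<close> decide. The
  Berezin transform is exactly the weighted diagonal of the kernel. Off-diagonal entries are
  recovered from it because the exponent is a polynomial in \<open>z\<close> and
  \<open>cnj z\<close> whose two linear coefficients can be decoupled into independent
  \<open>p\<close> and \<open>q\<close>, and a function holomorphic in \<open>(p, q)\<close> is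
  determined by its values where \<open>q = cnj p\<close>. One complex variable is enough: a complex
  line through \<open>(b, 0)\<close> meets that set in a real line. The definite description in
  \<open>toeplitz\<close> is met by an explicit integral, and all estimates are made against
  \<open>lborel\<close>, the square root of the Gaussian weight being absorbed into functions and
  kernels: there translations act and the majorants become convolutions.\<close>

lemma nn_integral_lborel_translate:
  fixes F :: "'a::euclidean_space \<Rightarrow> ennreal"
  assumes [measurable]: "F \<in> borel_measurable borel"
  shows "(\<integral>\<^sup>+x. F (a + x) \<partial>lborel) = (\<integral>\<^sup>+x. F x \<partial>lborel)"
  by (subst (2) lborel_distr_plus[of a, symmetric]) (simp add: nn_integral_distr)

lemma lborel_distr_reflect: "distr lborel borel (\<lambda>x. a - x) = (lborel :: 'a::euclidean_space measure)"
  using lborel_affine[of "-1" a] by (simp add: density_1)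

lemma nn_integral_lborel_reflect:
  fixes F :: "'a::euclidean_space \<Rightarrow> ennreal"
  assumes [measurable]: "F \<in> borel_measurable borel"
  shows "(\<integral>\<^sup>+x. F (a - x) \<partial>lborel) = (\<integral>\<^sup>+x. F x \<partial>lborel)"
  by (subst (2) lborel_distr_reflect[of a, symmetric]) (simp add: nn_integral_distr)

lemma integral_lborel_translate:
  fixes F :: "'a::euclidean_space \<Rightarrow> 'b::{banach, second_countable_topology}"
  assumes [measurable]: "F \<in> borel_measurable borel"
  shows "(LINT x|lborel. F (a + x)) = (LINT x|lborel. F x)"
  by (subst (2) lborel_distr_plus[of a, symmetric]) (simp add: integral_distr)

lemma integral_lborel_reflect:
  fixes F :: "'a::euclidean_space \<Rightarrow> 'b::{banach, second_countable_topology}"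
  assumes [measurable]: "F \<in> borel_measurable borel"
  shows "(LINT x|lborel. F (a - x)) = (LINT x|lborel. F x)"
  by (subst (2) lborel_distr_reflect[of a, symmetric]) (simp add: integral_distr)

text \<open>Layer cake: \<open>exp (- c |z|\<^sup>2)\<close> is the integral of \<open>c exp (- c s)\<close> over \<open>s \<ge> |z|\<^sup>2\<close>.\<close>

lemma nn_integral_gaussian:
  assumes c: "c > 0"
  shows "(\<integral>\<^sup>+z. ennreal (exp (- c * (cmod z)\<^sup>2)) \<partial>lborel) = ennreal (pi / c)"
proof -
  have 1: "ennreal (exp (- c * a)) = (\<integral>\<^sup>+s. ennreal (c * exp (- c * s)) * indicator {a..} s \<partial>lborel)" for a
  proof -
    have "((\<lambda>s. - exp (- c * s)) \<longlongrightarrow> 0) at_top"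
      using c by real_asymp
    then have "(\<integral>\<^sup>+s. ennreal (c * exp (- c * s)) * indicator {a..} s \<partial>lborel) = ennreal (0 - (- exp (- c * a)))"
      using c by (intro nn_integral_FTC_atLeast) (auto intro!: derivative_eq_intros)
    then show ?thesis by simp
  qed
  have 2: "(\<integral>\<^sup>+z. indicator {(cmod z)\<^sup>2 ..} s \<partial>lborel) = ennreal (pi * s) * indicator {0..} s" for s
  proof (cases "s \<ge> 0")
    case True
    have "(\<integral>\<^sup>+z. indicator {(cmod z)\<^sup>2 ..} s \<partial>lborel) = (\<integral>\<^sup>+z. indicator (cball 0 (sqrt s)) (z::complex) \<partial>lborel)"
    proof (rule nn_integral_cong)
      fix z :: complex
      have "(cmod z)\<^sup>2 \<le> s \<longleftrightarrow> cmod z \<le> sqrt s"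
        by (metis abs_norm_cancel real_sqrt_abs real_sqrt_le_iff)
      then show "indicator {(cmod z)\<^sup>2 ..} s = (indicator (cball 0 (sqrt s)) z :: ennreal)"
        by (simp add: indicator_def)
    qed
    also have "\<dots> = ennreal (pi * s)"
      using True by (simp add: emeasure_cball unit_ball_vol_2)
    finally show ?thesis using True by simp
  next
    case False
    then have "indicator {(cmod z)\<^sup>2 ..} s = (0::ennreal)" for z
      using order_trans[OF zero_le_power2[of "cmod z"]] by (auto simp: indicator_def)
    then show ?thesis using False by simp
  qed
  have "(\<integral>\<^sup>+z. ennreal (exp (- c * (cmod z)\<^sup>2)) \<partial>lborel)
      = (\<integral>\<^sup>+z. (\<integral>\<^sup>+s. ennreal (c * exp (- c * s)) * indicator {(cmod z)\<^sup>2 ..} s \<partial>lborel) \<partial>lborel)"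
    by (simp only: 1)
  also have "\<dots> = (\<integral>\<^sup>+s. (\<integral>\<^sup>+z. ennreal (c * exp (- c * s)) * indicator {(cmod z)\<^sup>2 ..} s \<partial>lborel) \<partial>lborel)"
    by (rule lborel_pair.Fubini') (simp add: indicator_def)
  also have "\<dots> = (\<integral>\<^sup>+s. ennreal (c * exp (- c * s)) * (\<integral>\<^sup>+z. indicator {(cmod z)\<^sup>2 ..} s \<partial>lborel) \<partial>lborel)"
    by (intro nn_integral_cong nn_integral_cmult) (simp add: indicator_def)
  also have "\<dots> = (\<integral>\<^sup>+s. ennreal (c * exp (- c * s) * (pi * s)) * indicator {0..} s \<partial>lborel)"
    unfolding 2 using c by (intro nn_integral_cong) (auto simp: indicator_def ennreal_mult')
  \<comment> \<open>Integration by parts gives the antiderivative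
    \<open>- pi * (s + 1 / c) * exp (- c * s)\<close>; the value is its limit 0 at infinity minus
    its value at 0.\<close>
  also have "\<dots> = ennreal (0 - (- pi * (0 + 1 / c) * exp (- c * 0)))"
  proof (rule nn_integral_FTC_atLeast)
    show "((\<lambda>s. - pi * (s + 1 / c) * exp (- c * s)) \<longlongrightarrow> 0) at_top"
      using c by real_asymp
    show "DERIV (\<lambda>s. - pi * (s + 1 / c) * exp (- c * s)) s :> c * exp (- c * s) * (pi * s)" for s
      using c by (auto intro!: derivative_eq_intros simp: field_simps)
  qed (use c in auto)
  finally show ?thesis by simp
qed

lemma integrable_gaussian:
  assumes "c > 0"
  shows "integrable lborel (\<lambda>z::complex. exp (- c * (cmod z)\<^sup>2))"
  by (rule integrableI_nonneg) (use nn_integral_gaussian[OF assms] in auto)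

text \<open>Translation invariance characterises Lebesgue measure up to a factor, and the factor is
  read off on the unit disc, which is preserved by rotations.\<close>

lemma lborel_distr_rotation:
  assumes c: "cmod c = 1"
  shows "distr lborel borel ((*) c) = (lborel :: complex measure)"
proof (rule measure_eqI)
  have c0: "c \<noteq> 0" using c by auto
  show "sets (distr lborel borel ((*) c)) = sets (lborel :: complex measure)" by simp
  fix A :: "complex set" assume "A \<in> sets (distr lborel borel ((*) c))"
  then have A [measurable]: "A \<in> sets borel" by simp
  define B where "B = ball (0::complex) 1"
  have [measurable]: "B \<in> sets borel" by (simp add: B_def)
  let ?L = "emeasure (lborel :: complex measure)"
  have B: "(\<integral>\<^sup>+x. indicator B (y - c * x) \<partial>lborel) = ?L B" for y
  proof -
    have "cmod (y / c - x) = cmod (y - c * x)" for x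
    proof -
      have "y / c - x = (y - c * x) / c" using c0 by (simp add: field_simps)
      then show ?thesis using c by (simp add: norm_divide)
    qed
    then have "(\<integral>\<^sup>+x. indicator B (y - c * x) \<partial>lborel) = (\<integral>\<^sup>+x. indicator B (y / c - x) \<partial>lborel)"
      by (intro nn_integral_cong) (auto simp: B_def indicator_def)
    also have "\<dots> = (\<integral>\<^sup>+x. indicator B x \<partial>lborel)"
      by (rule nn_integral_lborel_reflect) simp
    finally show ?thesis by simp
  qed
  \<comment> \<open>The uniqueness argument for Haar measure: the double integral of
    \<open>indicator A (c * x + y) * indicator B y\<close> is evaluated by absorbing a translation
    in \<open>x\<close> and, after exchanging the order, one in \<open>y\<close>.\<close>
  have "emeasure (distr lborel borel ((*) c)) A * ?L B = (\<integral>\<^sup>+x. indicator A (c * x) \<partial>lborel) * ?L B"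
    by (simp add: nn_integral_distr flip: nn_integral_indicator)
  also have "\<dots> = (\<integral>\<^sup>+y. (\<integral>\<^sup>+x. indicator A (c * x) \<partial>lborel) * indicator B y \<partial>lborel)"
    by (simp add: nn_integral_cmult)
  also have "\<dots> = (\<integral>\<^sup>+y. (\<integral>\<^sup>+x. indicator A (c * x + y) * indicator B y \<partial>lborel) \<partial>lborel)"
  proof (rule nn_integral_cong)
    fix y :: complex
    have "(\<integral>\<^sup>+x. indicator A (c * x) \<partial>lborel) = ((\<integral>\<^sup>+x. indicator A (c * (y / c + x)) \<partial>lborel) :: ennreal)"
      by (rule nn_integral_lborel_translate[symmetric]) measurable
    also have "(\<lambda>x. c * (y / c + x)) = (\<lambda>x. c * x + y)"
      using c0 by (auto simp: field_simps)
    finally show "(\<integral>\<^sup>+x. indicator A (c * x) \<partial>lborel) * indicator B y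
        = (\<integral>\<^sup>+x. indicator A (c * x + y) * indicator B y \<partial>lborel)"
      by (simp add: nn_integral_multc)
  qed
  also have "\<dots> = (\<integral>\<^sup>+x. (\<integral>\<^sup>+y. indicator A (c * x + y) * indicator B y \<partial>lborel) \<partial>lborel)"
    by (rule lborel_pair.Fubini') measurable
  also have "\<dots> = (\<integral>\<^sup>+x. (\<integral>\<^sup>+y. indicator A y * indicator B (y - c * x) \<partial>lborel) \<partial>lborel)"
  proof (rule nn_integral_cong)
    fix x :: complex
    have "(\<integral>\<^sup>+y. indicator A (c * x + y) * indicator B (c * x + y - c * x) \<partial>lborel)
        = ((\<integral>\<^sup>+y. indicator A y * indicator B (y - c * x) \<partial>lborel) :: ennreal)"
      by (rule nn_integral_lborel_translate) measurable
    then show "(\<integral>\<^sup>+y. indicator A (c * x + y) * indicator B y \<partial>lborel)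
        = ((\<integral>\<^sup>+y. indicator A y * indicator B (y - c * x) \<partial>lborel) :: ennreal)"
      by simp
  qed
  also have "\<dots> = (\<integral>\<^sup>+y. (\<integral>\<^sup>+x. indicator A y * indicator B (y - c * x) \<partial>lborel) \<partial>lborel)"
    by (rule lborel_pair.Fubini') measurable
  also have "\<dots> = ?L A * ?L B"
    by (simp add: nn_integral_cmult B nn_integral_multc)
  finally have eq: "emeasure (distr lborel borel ((*) c)) A * ?L B = ?L A * ?L B" .
  have "?L B = ennreal pi"
    by (simp add: B_def emeasure_ball unit_ball_vol_2)
  then have "?L B \<noteq> 0" "?L B \<noteq> top" by auto
  then show "emeasure (distr lborel borel ((*) c)) A = emeasure lborel A"
    using eq by (simp add: mult.commute[of _ "?L B"] ennreal_mult_cancel_left)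
qed

section \<open>Integration and rotation invariance for the Gaussian measure\<close>

lemma integral_gauss:
  fixes F :: "complex \<Rightarrow> 'b::{banach, second_countable_topology}"
  assumes [measurable]: "F \<in> borel_measurable borel"
  shows "(LINT z|gauss. F z) = (LINT z|lborel. (exp (- (cmod z)\<^sup>2) / pi) *\<^sub>R F z)"
  unfolding gauss_def by (rule integral_density) auto

lemma integrable_gauss:
  fixes F :: "complex \<Rightarrow> 'b::{banach, second_countable_topology}"
  assumes [measurable]: "F \<in> borel_measurable borel"
  shows "integrable gauss F \<longleftrightarrow> integrable lborel (\<lambda>z. (exp (- (cmod z)\<^sup>2) / pi) *\<^sub>R F z)"
  unfolding gauss_def by (rule integrable_density) auto

lemma nn_integral_gauss:
  assumes [measurable]: "F \<in> borel_measurable borel"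
  shows "(\<integral>\<^sup>+z. F z \<partial>gauss) = (\<integral>\<^sup>+z. ennreal (exp (- (cmod z)\<^sup>2) / pi) * F z \<partial>lborel)"
  unfolding gauss_def by (rule nn_integral_density) auto

lemma emeasure_gauss_space: "emeasure gauss (space gauss) = 1"
proof -
  have "emeasure gauss (space gauss) = (\<integral>\<^sup>+z. 1 \<partial>gauss)" by simp
  also have "\<dots> = (\<integral>\<^sup>+z. ennreal (1 / pi) * ennreal (exp (- 1 * (cmod z)\<^sup>2)) \<partial>lborel)"
    by (subst nn_integral_gauss) (auto simp flip: ennreal_mult)
  also have "\<dots> = ennreal (1 / pi) * ennreal (pi / 1)"
    by (subst nn_integral_cmult) (auto simp only: nn_integral_gaussian, auto)
  also have "\<dots> = 1" by (simp flip: ennreal_mult)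
  finally show ?thesis .
qed

interpretation gauss: finite_measure gauss
  by standard (simp add: emeasure_gauss_space)

lemma distr_gauss_rotation:
  assumes c: "cmod c = 1"
  shows "distr gauss borel ((*) c) = gauss"
proof -
  have "gauss = density (distr lborel borel ((*) c)) (\<lambda>z. ennreal (exp (- (cmod z)\<^sup>2) / pi))"
    unfolding lborel_distr_rotation[OF c] by (simp add: gauss_def)
  also have "\<dots> = distr (density lborel (\<lambda>z. ennreal (exp (- (cmod (c * z))\<^sup>2) / pi))) borel ((*) c)"
    by (rule density_distr) auto
  also have "\<dots> = distr gauss borel ((*) c)"
    using c by (simp add: gauss_def norm_mult)
  finally show ?thesis by simp
qed

section \<open>Mean values of entire functions\<close>

text \<open>Cauchy's formula on the unit circle for \<open>u \<mapsto> F (u * z)\<close>. Scaling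
  the argument instead of the circle treats \<open>z = 0\<close> along with the rest.\<close>

lemma circle_mean_value:
  assumes F: "F holomorphic_on UNIV"
  shows "((\<lambda>t. F (exp (2 * of_real pi * \<i> * of_real t) * z)) has_integral F 0) {0..1::real}"
proof -
  have "(F \<circ> (\<lambda>u. u * z)) holomorphic_on cball 0 1"
    by (rule holomorphic_on_compose_gen[OF _ F]) (auto intro!: holomorphic_intros)
  then have "(\<lambda>u. F (u * z)) holomorphic_on cball 0 1"
    by (simp add: o_def)
  then have "((\<lambda>u. F (u * z) / (u - 0)) has_contour_integral (2 * of_real pi * \<i> * F (0 * z))) (circlepath 0 1)"
    by (rule Cauchy_integral_circlepath_simple) auto
  then have "((\<lambda>u. F (u * z) / u) has_contour_integral (2 * of_real pi * \<i> * F 0)) (circlepath 0 1)"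
    by simp
  then have "((\<lambda>t. (2 * of_real pi * \<i>) * F (exp (2 * of_real pi * \<i> * of_real t) * z)) has_integral (2 * of_real pi * \<i> * F 0)) {0..1::real}"
    unfolding has_contour_integral
    by (rule has_integral_eq[rotated]) (simp add: vector_derivative_circlepath, simp add: circlepath)
  then have "((\<lambda>t. inverse (2 * of_real pi * \<i>) * ((2 * of_real pi * \<i>) * F (exp (2 * of_real pi * \<i> * of_real t) * z)))
      has_integral inverse (2 * of_real pi * \<i>) * (2 * of_real pi * \<i> * F 0)) {0..1::real}"
    by (rule has_integral_mult_right)
  moreover have "inverse (2 * of_real pi * \<i>) * ((2 * of_real pi * \<i>) * a) = a" for a
    by (simp add: field_simps)
  ultimately show ?thesis by (simp only:)
qed

text \<open>By rotation invariance the integral is unchanged if \<open>F\<close> is first averaged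
  over all rotations. That average is the constant \<open>F 0\<close>, and \<open>gauss\<close> has
  total mass 1.\<close>

lemma gauss_mean_value:
  assumes F: "F holomorphic_on UNIV" and int: "integrable gauss F"
  shows "(LINT z|gauss. F z) = F 0"
proof -
  have cont: "continuous_on UNIV F" using F by (rule holomorphic_on_imp_continuous_on)
  have [measurable]: "F \<in> borel_measurable borel" using cont by (rule borel_measurable_continuous_onI)
  define e where "e t = exp (2 * of_real pi * \<i> * complex_of_real t)" for t
  have [measurable]: "e \<in> borel_measurable borel"
    unfolding e_def by (intro borel_measurable_continuous_onI continuous_intros)
  have e: "cmod (e t) = 1" for t by (simp add: e_def norm_exp_eq_Re)
  have rot: "(LINT z|gauss. G (e t * z)) = (LINT z|gauss. G z)"
    if [measurable]: "G \<in> borel_measurable borel" for G :: "complex \<Rightarrow> 'b::{banach,second_countable_topology}" and t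
    by (subst (2) distr_gauss_rotation[OF e[of t], symmetric]) (simp add: integral_distr)
  have roti: "integrable gauss (\<lambda>z. G (e t * z)) \<longleftrightarrow> integrable gauss G"
    if [measurable]: "G \<in> borel_measurable borel" for G :: "complex \<Rightarrow> 'b::{banach,second_countable_topology}" and t
    by (subst (2) distr_gauss_rotation[OF e[of t], symmetric]) (simp add: integrable_distr_eq)
  define M where "M = restrict_space lborel {0..1::real}"
  interpret M: finite_measure M
    by standard (simp add: M_def emeasure_restrict_space space_restrict_space)
  interpret P: pair_sigma_finite M gauss ..
  have [measurable]: "(\<lambda>t. t) \<in> measurable M borel" by (simp add: M_def measurable_restrict_space1)
  have mM: "measure M (space M) = 1"
    by (simp add: M_def measure_restrict_space space_restrict_space)
  have inner: "(LINT t|M. F (e t * z)) = F 0" for z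
  proof -
    have c: "continuous_on {0..1} (\<lambda>t. F (e t * z))"
      unfolding e_def by (intro continuous_on_compose2[OF cont] continuous_intros) auto
    have "(LINT t|M. F (e t * z)) = (LINT t:{0..1}|lborel. F (e t * z))"
      unfolding M_def by (subst integral_restrict_space) (auto simp: set_lebesgue_integral_def)
    also have "\<dots> = integral {0..1} (\<lambda>t. F (e t * z))"
      by (rule set_borel_integral_eq_integral) (rule borel_integrable_atLeastAtMost', rule c)
    also have "\<dots> = F 0"
      unfolding e_def by (rule integral_unique[OF circle_mean_value[OF F]])
    finally show ?thesis .
  qed
  \<comment> \<open>Absolute convergence on the product: the inner integral of the norm does not
    depend on \<open>t\<close>, and \<open>M\<close> has finite mass.\<close>
  have "integrable (M \<Otimes>\<^sub>M gauss) (\<lambda>(t, z). F (e t * z))"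
  proof (rule P.Fubini_integrable)
    show "(\<lambda>(t, z). F (e t * z)) \<in> borel_measurable (M \<Otimes>\<^sub>M gauss)" by measurable
    show "integrable M (\<lambda>t. LINT z|gauss. norm (case (t, z) of (t, z) \<Rightarrow> F (e t * z)))"
      using rot[of "\<lambda>z. norm (F z)"] by simp
    show "AE t in M. integrable gauss (\<lambda>z. case (t, z) of (t, z) \<Rightarrow> F (e t * z))"
      using roti[of F] int by simp
  qed
  from P.Fubini_integral[OF this]
  have "(LINT z|gauss. F 0) = (LINT t|M. (LINT z|gauss. F z))"
    by (simp add: inner rot)
  then show ?thesis
    using emeasure_gauss_space mM by (simp add: measure_def)
qed

section \<open>Schur's test and holomorphic families\<close>

text \<open>The exponential series gives \<open>(t + P) ^ k \<le> fact k * exp (t + P)\<close>, and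
  completing the square pays for the remaining linear exponent \<open>(Q + 1) * t\<close> with half
  of the quadratic one. The Gaussian majorants below come from here.\<close>

lemma power_gaussian_bound:
  fixes c P Q :: real
  assumes c: "c > 0" and P: "P \<ge> 0"
  shows "\<exists>C\<ge>0. \<forall>t\<ge>0. (t + P) ^ k * exp (Q * t - c * t\<^sup>2) \<le> C * exp (- (c / 2) * t\<^sup>2)"
proof (intro exI conjI allI impI)
  let ?C = "fact k * exp (P + (Q + 1)\<^sup>2 / (2 * c)) :: real"
  show "0 \<le> ?C" by simp
  fix t :: real assume t: "t \<ge> 0"
  have "(t + P) ^ k / fact k \<le> (\<Sum>n. (t + P) ^ n /\<^sub>R fact n)"
    using sum_le_suminf[OF summable_exp_generic[of "t + P"], of "{k}"] t P
    by (simp add: divide_inverse mult.commute)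
  then have 1: "(t + P) ^ k \<le> fact k * exp (t + P)"
    by (simp add: exp_def field_simps)
  have "0 \<le> (c * t - (Q + 1))\<^sup>2 / (2 * c)" using c by simp
  also have "\<dots> = (c / 2) * t\<^sup>2 - (Q + 1) * t + (Q + 1)\<^sup>2 / (2 * c)"
    using c by (simp add: power2_eq_square field_simps)
  finally have 2: "t + P + (Q * t - c * t\<^sup>2) \<le> P + (Q + 1)\<^sup>2 / (2 * c) + - (c / 2) * t\<^sup>2"
    by (simp add: algebra_simps)
  have "(t + P) ^ k * exp (Q * t - c * t\<^sup>2) \<le> fact k * exp (t + P) * exp (Q * t - c * t\<^sup>2)"
    by (rule mult_right_mono[OF 1]) simp
  also have "\<dots> = fact k * exp (t + P + (Q * t - c * t\<^sup>2))"
    by (simp add: exp_add)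
  also have "\<dots> \<le> fact k * exp (P + (Q + 1)\<^sup>2 / (2 * c) + - (c / 2) * t\<^sup>2)"
    using 2 by simp
  also have "\<dots> = ?C * exp (- (c / 2) * t\<^sup>2)" by (simp only: exp_add mult.assoc)
  finally show "(t + P) ^ k * exp (Q * t - c * t\<^sup>2) \<le> ?C * exp (- (c / 2) * t\<^sup>2)" .
qed

text \<open>Cauchy-Schwarz for \<open>sqrt (K y)\<close> and \<open>sqrt (K y) * G y\<close>, so
  that the total mass of \<open>K\<close> splits off.\<close>

lemma Cauchy_Schwarz_weighted:
  fixes K :: "'a \<Rightarrow> real"
  assumes [measurable]: "K \<in> borel_measurable M" "G \<in> borel_measurable M" and K: "\<And>y. 0 \<le> K y"
  shows "(\<integral>\<^sup>+y. ennreal (K y) * G y \<partial>M)\<^sup>2 \<le> (\<integral>\<^sup>+y. ennreal (K y) \<partial>M) * (\<integral>\<^sup>+y. ennreal (K y) * (G y)\<^sup>2 \<partial>M)"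
proof -
  have K2: "ennreal (sqrt (K y)) * ennreal (sqrt (K y)) = ennreal (K y)" for y
    using K[of y] by (simp flip: ennreal_mult)
  have "(\<integral>\<^sup>+y. ennreal (sqrt (K y)) * (ennreal (sqrt (K y)) * G y) \<partial>M)\<^sup>2
      \<le> (\<integral>\<^sup>+y. (ennreal (sqrt (K y)))\<^sup>2 \<partial>M) * (\<integral>\<^sup>+y. (ennreal (sqrt (K y)) * G y)\<^sup>2 \<partial>M)"
    by (rule Cauchy_Schwarz_nn_integral) auto
  then show ?thesis
    by (simp add: K2 power2_eq_square mult.assoc[symmetric])
       (simp add: K2 mult.commute mult.left_commute mult.assoc)
qed

text \<open>The column integrals of the kernel are kept as a weight: it is their decay at infinity that
  yields compactness below.\<close>

lemma Schur_test:
  fixes K :: "'a \<Rightarrow> 'b \<Rightarrow> real"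
  assumes "sigma_finite_measure M" "sigma_finite_measure N"
    and [measurable]: "(\<lambda>(x, y). K x y) \<in> borel_measurable (M \<Otimes>\<^sub>M N)" "G \<in> borel_measurable N"
    and K: "\<And>x y. 0 \<le> K x y" and a: "\<And>x. (\<integral>\<^sup>+y. ennreal (K x y) \<partial>N) \<le> a"
  shows "(\<integral>\<^sup>+x. (\<integral>\<^sup>+y. ennreal (K x y) * G y \<partial>N)\<^sup>2 \<partial>M)
      \<le> a * (\<integral>\<^sup>+y. (\<integral>\<^sup>+x. ennreal (K x y) \<partial>M) * (G y)\<^sup>2 \<partial>N)"
proof -
  interpret N: sigma_finite_measure N by fact
  interpret pair_sigma_finite M N using assms by (simp add: pair_sigma_finite_def)
  have [measurable]: "K x \<in> borel_measurable N" if "x \<in> space M" for x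
    using that by measurable
  have "(\<integral>\<^sup>+x. (\<integral>\<^sup>+y. ennreal (K x y) * G y \<partial>N)\<^sup>2 \<partial>M) \<le> (\<integral>\<^sup>+x. a * (\<integral>\<^sup>+y. ennreal (K x y) * (G y)\<^sup>2 \<partial>N) \<partial>M)"
    by (intro nn_integral_mono order_trans[OF Cauchy_Schwarz_weighted] mult_right_mono a K) auto
  also have "\<dots> = a * (\<integral>\<^sup>+x. (\<integral>\<^sup>+y. ennreal (K x y) * (G y)\<^sup>2 \<partial>N) \<partial>M)"
    by (rule nn_integral_cmult) measurable
  also have "(\<integral>\<^sup>+x. (\<integral>\<^sup>+y. ennreal (K x y) * (G y)\<^sup>2 \<partial>N) \<partial>M) = (\<integral>\<^sup>+y. (\<integral>\<^sup>+x. ennreal (K x y) * (G y)\<^sup>2 \<partial>M) \<partial>N)"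
    by (rule Fubini'[symmetric]) measurable
  also have "\<dots> = (\<integral>\<^sup>+y. (\<integral>\<^sup>+x. ennreal (K x y) \<partial>M) * (G y)\<^sup>2 \<partial>N)"
    by (intro nn_integral_cong nn_integral_multc) measurable
  finally show ?thesis .
qed

section \<open>Integrals and limits of holomorphic functions\<close>

text \<open>A majorant of the integrand is also one of its difference quotients: Cauchy's estimate
  on discs of radius 1 bounds the derivative by \<open>D\<close>, and the mean value inequality
  carries this over to the quotients. Dominated convergence then differentiates under the
  integral.\<close>

lemma holomorphic_on_lebesgue_integral:
  fixes \<Phi> :: "complex \<Rightarrow> 'a \<Rightarrow> complex"
  assumes meas [measurable]: "\<And>s. \<Phi> s \<in> borel_measurable M"
    and hol: "\<And>x. (\<lambda>s. \<Phi> s x) holomorphic_on UNIV"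
    and dom: "\<And>R. \<exists>D. integrable M D \<and> (\<forall>s x. cmod s \<le> R \<longrightarrow> cmod (\<Phi> s x) \<le> D x)"
  shows "(\<lambda>s. LINT x|M. \<Phi> s x) holomorphic_on UNIV"
  unfolding holomorphic_on_open[OF open_UNIV]
proof
  fix s0 :: complex
  \<comment> \<open>The 2 leaves one unit for \<open>s\<close> in \<open>ball s0 1\<close> and one
    for the circle around \<open>s\<close> in Cauchy's estimate.\<close>
  obtain D where D: "integrable M D" "\<And>s x. cmod s \<le> cmod s0 + 2 \<Longrightarrow> cmod (\<Phi> s x) \<le> D x"
    using dom[of "cmod s0 + 2"] by blast
  have int: "integrable M (\<Phi> s)" if "cmod s \<le> cmod s0 + 2" for s
    by (rule Bochner_Integration.integrable_bound[OF D(1)]) (use D(2)[OF that] in \<open>auto intro!: AE_I2 intro: order_trans[OF _ abs_ge_self]\<close>)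
  have der: "((\<lambda>s. \<Phi> s x) has_field_derivative deriv (\<lambda>s. \<Phi> s x) s) (at s)" for s x
    by (rule holomorphic_derivI[OF hol open_UNIV]) simp
  have der_bound: "cmod (deriv (\<lambda>s. \<Phi> s x) s) \<le> D x" if "s \<in> ball s0 1" for s x
  proof -
    have "cmod ((deriv ^^ 1) (\<lambda>s. \<Phi> s x) s) \<le> fact 1 * D x / 1 ^ 1"
    proof (rule Cauchy_inequality)
      show "(\<lambda>s. \<Phi> s x) holomorphic_on ball s 1" using hol by (rule holomorphic_on_subset) auto
      show "continuous_on (cball s 1) (\<lambda>s. \<Phi> s x)"
        using hol by (rule holomorphic_on_imp_continuous_on[OF holomorphic_on_subset]) auto
      fix y assume "cmod (s - y) = 1"
      then have "cmod y \<le> cmod s0 + 2"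
        using that norm_triangle_ineq4[of s "s - y"] norm_triangle_ineq[of s0 "s - s0"]
        by (auto simp: dist_norm norm_minus_commute)
      then show "cmod (\<Phi> y x) \<le> D x" by (rule D(2))
    qed simp
    then show ?thesis by simp
  qed
  have quot: "cmod ((\<Phi> s x - \<Phi> s0 x) / (s - s0)) \<le> D x" if "s \<in> ball s0 1" "s \<noteq> s0" for s x
  proof -
    have "cmod (\<Phi> s x - \<Phi> s0 x) \<le> D x * cmod (s - s0)"
      by (rule field_differentiable_bound[of "ball s0 1" _ "deriv (\<lambda>s. \<Phi> s x)"])
        (use that der der_bound in \<open>auto intro: has_field_derivative_at_within\<close>)
    then show ?thesis using that by (simp add: norm_divide field_simps)
  qed
  have "((\<lambda>s. ((LINT x|M. \<Phi> s x) - (LINT x|M. \<Phi> s0 x)) / (s - s0)) \<longlongrightarrow> (LINT x|M. deriv (\<lambda>s. \<Phi> s x) s0)) (at s0)"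
    unfolding tendsto_at_iff_sequentially
  proof (intro allI impI)
    fix X :: "nat \<Rightarrow> complex" assume X: "\<forall>i. X i \<in> UNIV - {s0}" "X \<longlonglongrightarrow> s0"
    have "\<forall>\<^sub>F n in sequentially. X n \<in> ball s0 1"
      using X(2) by (rule topological_tendstoD) auto
    then obtain N where N: "\<And>n. n \<ge> N \<Longrightarrow> X n \<in> ball s0 1"
      by (auto simp: eventually_sequentially)
    \<comment> \<open>Dropping an initial segment puts every term into the ball, so that the
      majorant holds for all \<open>n\<close>.\<close>
    define Y where "Y n = X (n + N)" for n
    have Y: "Y n \<in> ball s0 1" "Y n \<noteq> s0" for n using N X(1) by (auto simp: Y_def)
    have Ylim: "Y \<longlonglongrightarrow> s0" unfolding Y_def by (rule LIMSEQ_ignore_initial_segment[OF X(2)])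
    have "cmod (Y n) \<le> cmod s0 + 2" for n
      using Y(1)[of n] norm_triangle_ineq[of s0 "Y n - s0"] by (auto simp: dist_norm norm_minus_commute)
    then have eq: "(LINT x|M. (\<Phi> (Y n) x - \<Phi> s0 x) / (Y n - s0)) = ((LINT x|M. \<Phi> (Y n) x) - (LINT x|M. \<Phi> s0 x)) / (Y n - s0)" for n
      by (simp add: Bochner_Integration.integral_diff[OF int int])
    have lim: "(\<lambda>n. (\<Phi> (Y n) x - \<Phi> s0 x) / (Y n - s0)) \<longlonglongrightarrow> deriv (\<lambda>s. \<Phi> s x) s0" for x
      using der[of x s0] Y(2) Ylim unfolding has_field_derivative_iff tendsto_at_iff_sequentially
      by (auto simp: o_def)
    have "(\<lambda>n. LINT x|M. (\<Phi> (Y n) x - \<Phi> s0 x) / (Y n - s0)) \<longlonglongrightarrow> (LINT x|M. deriv (\<lambda>s. \<Phi> s x) s0)"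
    proof (rule integral_dominated_convergence[where w = D])
      show "(\<lambda>x. deriv (\<lambda>s. \<Phi> s x) s0) \<in> borel_measurable M"
        by (rule borel_measurable_LIMSEQ_metric[OF _ lim]) measurable
    qed (use D(1) lim quot[OF Y] in auto)
    then have "(\<lambda>n. ((LINT x|M. \<Phi> (X (n + N)) x) - (LINT x|M. \<Phi> s0 x)) / (X (n + N) - s0)) \<longlonglongrightarrow> (LINT x|M. deriv (\<lambda>s. \<Phi> s x) s0)"
      by (simp only: eq) (simp add: Y_def)
    then show "((\<lambda>s. ((LINT x|M. \<Phi> s x) - (LINT x|M. \<Phi> s0 x)) / (s - s0)) \<circ> X) \<longlonglongrightarrow> (LINT x|M. deriv (\<lambda>s. \<Phi> s x) s0)"
      unfolding o_def by (rule LIMSEQ_offset)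
  qed
  then show "\<exists>f'. ((\<lambda>s. LINT x|M. \<Phi> s x) has_field_derivative f') (at s0)"
    unfolding has_field_derivative_iff by blast
qed

text \<open>An instance of Vitali's theorem.\<close>

lemma tendsto_zero_from_real_axis:
  fixes h :: "nat \<Rightarrow> complex \<Rightarrow> complex"
  assumes hol: "\<And>n. h n holomorphic_on UNIV"
    and bound: "\<And>R. \<exists>B. \<forall>n s. cmod s \<le> R \<longrightarrow> cmod (h n s) \<le> B"
    and real: "\<And>x::real. (\<lambda>n. h n (of_real x)) \<longlonglongrightarrow> 0"
  shows "(\<lambda>n. h n s) \<longlonglongrightarrow> 0"
proof (rule ccontr)
  assume "\<not> (\<lambda>n. h n s) \<longlonglongrightarrow> 0"
  then obtain e where e: "e > 0" "\<not> (\<forall>\<^sub>F n in sequentially. cmod (h n s) < e)"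
    by (auto simp: tendsto_iff)
  then have "\<exists>\<^sub>F n in sequentially. e \<le> cmod (h n s)"
    by (simp add: frequently_def not_le)
  then have inf: "infinite {n. e \<le> cmod (h n s)}"
    by (simp add: cofinite_eq_sequentially[symmetric] frequently_cofinite)
  define r where "r = enumerate {n. e \<le> cmod (h n s)}"
  have r: "strict_mono r" "\<And>n. e \<le> cmod (h (r n) s)"
    using strict_mono_enumerate[OF inf] enumerate_in_set[OF inf] by (auto simp: r_def)
  have bnd: "\<exists>B. \<forall>h\<in>range h. \<forall>z\<in>K. cmod (h z) \<le> B" if K: "compact K" for K
  proof -
    obtain R where R: "\<And>z. z \<in> K \<Longrightarrow> cmod z \<le> R"
      using compact_imp_bounded[OF K] by (auto simp: bounded_iff)
    obtain B where "\<And>n s. cmod s \<le> R \<Longrightarrow> cmod (h n s) \<le> B"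
      using bound[of R] by blast
    with R show ?thesis by blast
  qed
  \<comment> \<open>Along a subsequence that stays at least \<open>e\<close> at \<open>s\<close>, a
    Montel limit vanishes on the real axis, hence everywhere by the identity theorem, in particular
    at \<open>s\<close>.\<close>
  obtain g q where g: "g holomorphic_on UNIV" and q: "strict_mono (q :: nat \<Rightarrow> nat)"
    and "\<And>x. x \<in> UNIV \<Longrightarrow> (\<lambda>n. (\<lambda>n. h (r n)) (q n) x) \<longlonglongrightarrow> g x"
    by (rule Montel[of UNIV "range h" "\<lambda>n. h (r n)"]) (use hol bnd in blast)+
  then have lim: "\<And>x. (\<lambda>n. h (r (q n)) x) \<longlonglongrightarrow> g x" by simp
  have g0: "g (of_real x) = 0" for x :: real
  proof (rule LIMSEQ_unique[OF lim])
    show "(\<lambda>n. h (r (q n)) (of_real x)) \<longlonglongrightarrow> 0"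
      using LIMSEQ_subseq_LIMSEQ[OF real[of x] strict_mono_o[OF r(1) q]] by (simp add: o_def)
  qed
  have lp: "(0::complex) islimpt \<real>"
    unfolding islimpt_approachable
  proof (intro allI impI)
    fix e :: real assume "e > 0"
    then show "\<exists>x\<in>\<real>. x \<noteq> (0::complex) \<and> dist x 0 < e"
      by (intro bexI[of _ "of_real (e / 2)"]) auto
  qed
  have gR: "g z = 0" if "z \<in> \<real>" for z
    using that g0 by (auto elim: Reals_cases)
  have "g s = 0"
    by (rule analytic_continuation[OF g open_UNIV connected_UNIV subset_UNIV UNIV_I lp gR UNIV_I])
  then have "(\<lambda>n. cmod (h (r (q n)) s)) \<longlonglongrightarrow> 0"
    using lim[of s] by (simp add: tendsto_norm_zero)
  then have "e \<le> 0"
    by (rule LIMSEQ_le_const) (use r(2) in auto)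
  with e show False by simp
qed

section \<open>Fock space\<close>

text \<open>The square root of the Gaussian density, up to its constant, is moved into the function,
  so that the Fock norm becomes an \<open>L^2\<close> norm for \<open>lborel\<close>. The omitted
  constant is the source of the factors \<open>pi\<close> below.\<close>

definition flat :: "(complex \<Rightarrow> complex) \<Rightarrow> complex \<Rightarrow> real" where
  "flat g w = cmod (g w) * exp (- (cmod w)\<^sup>2 / 2)"

text \<open>This is \<open>fock_U z (fock_basis j)\<close>.\<close>

definition coherent :: "nat \<Rightarrow> complex \<Rightarrow> complex \<Rightarrow> complex" where
  "coherent j z w = (z - w) ^ j / complex_of_real (sqrt (fact j)) * exp (w * cnj z - complex_of_real ((cmod z)\<^sup>2 / 2))"

text \<open>This is \<open>flat (fock_basis j)\<close>. The weighted moduli of all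
  \<open>coherent j z\<close> are its translates.\<close>

definition profile :: "nat \<Rightarrow> complex \<Rightarrow> real" where
  "profile j v = cmod v ^ j / sqrt (fact j) * exp (- (cmod v)\<^sup>2 / 2)"

lemma flat_nonneg [simp]: "0 \<le> flat g w"
  by (simp add: flat_def)

lemma profile_nonneg [simp]: "0 \<le> profile j v"
  by (simp add: profile_def)

lemma profile_minus_commute: "profile j (a - b) = profile j (b - a)"
  by (simp add: profile_def norm_minus_commute)

lemma borel_measurable_flat [measurable (raw)]:
  assumes [measurable]: "g \<in> borel_measurable borel" "u \<in> borel_measurable M"
  shows "(\<lambda>x. flat g (u x)) \<in> borel_measurable M"
  unfolding flat_def by measurable

lemma borel_measurable_profile [measurable]: "profile j \<in> borel_measurable borel"
  unfolding profile_def by measurable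

lemma borel_measurable_cnj [measurable]: "cnj \<in> borel_measurable borel"
  by (intro borel_measurable_continuous_onI continuous_intros)

lemma borel_measurable_coherent [measurable (raw)]:
  assumes [measurable]: "u \<in> borel_measurable M" "v \<in> borel_measurable M"
  shows "(\<lambda>x. coherent j (u x) (v x)) \<in> borel_measurable M"
  unfolding coherent_def by measurable

lemma ennreal_power2_le_imp_le:
  fixes x :: ennreal
  assumes "x\<^sup>2 \<le> (ennreal r)\<^sup>2" "0 \<le> r"
  shows "x \<le> ennreal r"
  using assms by (cases x) (auto simp: ennreal_power power_top_ennreal top_unique dest: power2_le_imp_le)

lemma cmod_diff_square: "(cmod (z - w))\<^sup>2 = (cmod z)\<^sup>2 + (cmod w)\<^sup>2 - 2 * Re (w * cnj z)"
  unfolding cmod_power2 by (simp add: power2_eq_square algebra_simps)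

lemma cmod_coherent: "cmod (coherent j z w) = profile j (z - w) * exp ((cmod w)\<^sup>2 / 2)"
proof -
  have "Re (w * cnj z) - (cmod z)\<^sup>2 / 2 = - (cmod (z - w))\<^sup>2 / 2 + (cmod w)\<^sup>2 / 2"
    unfolding cmod_diff_square by (simp add: field_simps)
  then have "cmod (exp (w * cnj z - complex_of_real ((cmod z)\<^sup>2 / 2)))
      = exp (- (cmod (z - w))\<^sup>2 / 2) * exp ((cmod w)\<^sup>2 / 2)"
    by (simp add: norm_exp_eq_Re flip: exp_add)
  then show ?thesis
    by (simp add: coherent_def profile_def norm_mult norm_divide norm_power)
qed

lemma flat_coherent: "flat (coherent j z) w = profile j (z - w)"
  by (simp add: flat_def cmod_coherent exp_minus)

lemma nn_integral_profile_finite: "(\<integral>\<^sup>+v. ennreal (profile j v) \<partial>lborel) < \<infinity>"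
proof -
  obtain C where C: "C \<ge> 0" "\<And>t::real. t \<ge> 0 \<Longrightarrow> (t + 0) ^ j * exp (0 * t - (1 / 2) * t\<^sup>2) \<le> C * exp (- ((1 / 2) / 2) * t\<^sup>2)"
    using power_gaussian_bound[of "1/2" 0 j 0] by auto
  have le: "profile j v \<le> C * exp (- (1 / 4) * (cmod v)\<^sup>2)" for v
  proof -
    have "1 \<le> sqrt (fact j)" by simp
    then have "cmod v ^ j / sqrt (fact j) \<le> cmod v ^ j / 1"
      by (intro divide_left_mono) auto
    then have "profile j v \<le> cmod v ^ j * exp (- (cmod v)\<^sup>2 / 2)"
      unfolding profile_def by (intro mult_right_mono) auto
    with C(2)[of "cmod v"] show ?thesis by simp
  qed
  have "(\<integral>\<^sup>+v. ennreal (profile j v) \<partial>lborel) \<le> (\<integral>\<^sup>+v. ennreal C * ennreal (exp (- (1 / 4) * (cmod v)\<^sup>2)) \<partial>lborel)"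
    using le C(1) by (intro nn_integral_mono) (simp add: ennreal_leI flip: ennreal_mult)
  also have "\<dots> = ennreal C * ennreal (pi / (1 / 4))"
    by (subst nn_integral_cmult) (simp, subst nn_integral_gaussian, auto)
  finally show ?thesis by (rule le_less_trans) (simp add: ennreal_mult_less_top)
qed

definition profile_mass :: "nat \<Rightarrow> ennreal" where
  "profile_mass j = (\<integral>\<^sup>+v. ennreal (profile j v) \<partial>lborel)"

lemma profile_mass_finite: "profile_mass j < \<infinity>"
  unfolding profile_mass_def by (rule nn_integral_profile_finite)

lemma profile_mass_shift:
  "(\<integral>\<^sup>+v. ennreal (profile j (v - a)) \<partial>lborel) = profile_mass j"
  "(\<integral>\<^sup>+v. ennreal (profile j (a - v)) \<partial>lborel) = profile_mass j"
  using nn_integral_lborel_translate[of "\<lambda>v. ennreal (profile j v)" "- a"]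
    nn_integral_lborel_reflect[of "\<lambda>v. ennreal (profile j v)" a]
  by (simp_all add: profile_mass_def)

lemma profile_le: "\<exists>B. \<forall>v. profile j v \<le> B"
proof -
  obtain C where C: "C \<ge> 0" "\<And>t::real. t \<ge> 0 \<Longrightarrow> (t + 0) ^ j * exp (0 * t - (1 / 2) * t\<^sup>2) \<le> C * exp (- ((1 / 2) / 2) * t\<^sup>2)"
    using power_gaussian_bound[of "1/2" 0 j 0] by auto
  have "profile j v \<le> C / sqrt (fact j)" for v
  proof -
    have "cmod v ^ j * exp (- (cmod v)\<^sup>2 / 2) \<le> C * exp (- (1 / 4) * (cmod v)\<^sup>2)"
      using C(2)[of "cmod v"] by simp
    also have "\<dots> \<le> C * 1" using C(1) by (intro mult_left_mono) auto
    finally show ?thesis by (simp add: profile_def divide_right_mono)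
  qed
  then show ?thesis by blast
qed

lemma nn_integral_flat:
  assumes [measurable]: "g \<in> borel_measurable borel"
  shows "(\<integral>\<^sup>+w. (ennreal (flat g w))\<^sup>2 \<partial>lborel) = ennreal pi * (\<integral>\<^sup>+z. ennreal ((cmod (g z))\<^sup>2) \<partial>gauss)"
proof -
  have "(\<integral>\<^sup>+z. ennreal ((cmod (g z))\<^sup>2) \<partial>gauss) = (\<integral>\<^sup>+w. ennreal (1 / pi) * (ennreal (flat g w))\<^sup>2 \<partial>lborel)"
    by (subst nn_integral_gauss, simp, intro nn_integral_cong)
       (simp add: flat_def ennreal_power power_mult_distrib exp_double[symmetric] mult.commute flip: ennreal_mult)
  also have "\<dots> = ennreal (1 / pi) * (\<integral>\<^sup>+w. (ennreal (flat g w))\<^sup>2 \<partial>lborel)"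
    by (rule nn_integral_cmult) measurable
  finally show ?thesis
    by (simp add: mult.assoc[symmetric] flip: ennreal_mult)
qed

lemma nn_integral_fock:
  assumes g: "g \<in> fock"
  shows "(\<integral>\<^sup>+z. ennreal ((cmod (g z))\<^sup>2) \<partial>gauss) = ennreal ((fock_norm g)\<^sup>2)"
  unfolding fock_norm_power2 using g by (intro nn_integral_eq_integral) (auto simp: fock_def)

lemma nn_integral_flat_fock:
  assumes g: "g \<in> fock"
  shows "(\<integral>\<^sup>+w. (ennreal (flat g w))\<^sup>2 \<partial>lborel) = ennreal pi * ennreal ((fock_norm g)\<^sup>2)"
  by (simp add: nn_integral_flat[OF fock_measurable[OF g]] nn_integral_fock[OF g])

lemma fockI:
  assumes g: "g holomorphic_on UNIV" and fin: "(\<integral>\<^sup>+w. (ennreal (flat g w))\<^sup>2 \<partial>lborel) < \<infinity>"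
  shows "g \<in> fock"
proof -
  have [measurable]: "g \<in> borel_measurable borel"
    using g by (intro borel_measurable_continuous_onI holomorphic_on_imp_continuous_on)
  have "(\<integral>\<^sup>+z. ennreal ((cmod (g z))\<^sup>2) \<partial>gauss) < \<infinity>"
    using fin by (auto simp: nn_integral_flat ennreal_mult_less_top ennreal_mult_eq_top_iff less_top)
  then have "integrable gauss (\<lambda>z. (cmod (g z))\<^sup>2)"
    by (intro integrableI_nonneg) auto
  with g show ?thesis by (simp add: fock_def)
qed

lemma holomorphic_coherent: "coherent j z holomorphic_on UNIV"
  unfolding coherent_def by (intro holomorphic_intros) auto

text \<open>\<open>profile j\<close> is bounded and integrable, hence square integrable, and so are
  its translates.\<close>

lemma coherent_in_fock: "coherent j z \<in> fock"
proof (rule fockI[OF holomorphic_coherent])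
  obtain B where B: "\<And>v. profile j v \<le> B" using profile_le[of j] by blast
  have "(\<integral>\<^sup>+w. (ennreal (flat (coherent j z) w))\<^sup>2 \<partial>lborel) \<le> (\<integral>\<^sup>+w. ennreal B * ennreal (profile j (z - w)) \<partial>lborel)"
    unfolding flat_coherent power2_eq_square
    by (intro nn_integral_mono mult_right_mono ennreal_leI B) auto
  also have "\<dots> = ennreal B * profile_mass j"
    by (subst nn_integral_cmult) (auto simp: profile_mass_shift)
  finally show "(\<integral>\<^sup>+w. (ennreal (flat (coherent j z) w))\<^sup>2 \<partial>lborel) < \<infinity>"
    using profile_mass_finite[of j] by (auto simp: ennreal_mult_less_top intro: le_less_trans)
qed

section \<open>Inner product, coherent states and the reproducing property\<close>

lemma fock_kernel_eq_coherent: "fock_kernel a = coherent 0 a"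
  by (simp add: fock_kernel_def coherent_def fun_eq_iff)

text \<open>The inequality is proved in \<open>ennreal\<close> for the absolute values; its
  finiteness gives the integrability, its value the bound.\<close>

lemma fock_Cauchy_Schwarz:
  assumes g: "g \<in> fock" and h: "h \<in> fock"
  shows "integrable gauss (\<lambda>w. g w * cnj (h w))" "cmod (fock_inner g h) \<le> fock_norm g * fock_norm h"
proof -
  have [measurable]: "g \<in> borel_measurable borel" "h \<in> borel_measurable borel"
    using g h by (auto intro: fock_measurable)
  have "(\<integral>\<^sup>+w. ennreal (cmod (g w * cnj (h w))) \<partial>gauss)\<^sup>2 = (\<integral>\<^sup>+w. ennreal (cmod (g w)) * ennreal (cmod (h w)) \<partial>gauss)\<^sup>2"
    by (simp add: norm_mult ennreal_mult)
  also have "\<dots> \<le> (\<integral>\<^sup>+w. (ennreal (cmod (g w)))\<^sup>2 \<partial>gauss) * (\<integral>\<^sup>+w. (ennreal (cmod (h w)))\<^sup>2 \<partial>gauss)"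
    by (rule Cauchy_Schwarz_nn_integral) auto
  also have "\<dots> = ennreal ((fock_norm g)\<^sup>2) * ennreal ((fock_norm h)\<^sup>2)"
    by (simp add: ennreal_power nn_integral_fock g h)
  also have "\<dots> = (ennreal (fock_norm g * fock_norm h))\<^sup>2"
    by (simp add: ennreal_power power_mult_distrib fock_norm_nonneg flip: ennreal_mult)
  finally have le: "(\<integral>\<^sup>+w. ennreal (cmod (g w * cnj (h w))) \<partial>gauss) \<le> ennreal (fock_norm g * fock_norm h)"
    by (rule ennreal_power2_le_imp_le) (simp add: fock_norm_nonneg)
  show int: "integrable gauss (\<lambda>w. g w * cnj (h w))"
    using le by (intro integrableI_bounded) (auto intro: le_less_trans)
  have "ennreal (cmod (fock_inner g h)) \<le> (\<integral>\<^sup>+w. ennreal (cmod (g w * cnj (h w))) \<partial>gauss)"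
    unfolding fock_inner_def by (rule integral_norm_bound_ennreal[OF int])
  then show "cmod (fock_inner g h) \<le> fock_norm g * fock_norm h"
    using le by (meson order_trans ennreal_le_iff fock_norm_nonneg mult_nonneg_nonneg)
qed

lemma fock_inner_cnj: "fock_inner f g = cnj (fock_inner g f)"
  unfolding fock_inner_def by (simp add: mult.commute flip: Bochner_Integration.integral_cnj)

lemma fock_inner_add_left:
  "f \<in> fock \<Longrightarrow> g \<in> fock \<Longrightarrow> h \<in> fock \<Longrightarrow> fock_inner (\<lambda>w. f w + g w) h = fock_inner f h + fock_inner g h"
  unfolding fock_inner_def by (simp add: distrib_right fock_Cauchy_Schwarz)

lemma fock_inner_diff_left:
  "f \<in> fock \<Longrightarrow> g \<in> fock \<Longrightarrow> h \<in> fock \<Longrightarrow> fock_inner (\<lambda>w. f w - g w) h = fock_inner f h - fock_inner g h"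
  unfolding fock_inner_def by (simp add: left_diff_distrib fock_Cauchy_Schwarz)

lemma fock_inner_cmult_left: "fock_inner (\<lambda>w. c * g w) h = c * fock_inner g h"
  unfolding fock_inner_def by (simp add: mult.assoc)

lemma fock_inner_self: "fock_inner f f = complex_of_real ((fock_norm f)\<^sup>2)"
proof -
  have "fock_inner f f = (LINT z|gauss. complex_of_real ((cmod (f z))\<^sup>2))"
    unfolding fock_inner_def by (simp add: complex_norm_square del: of_real_power)
  also have "\<dots> = complex_of_real ((fock_norm f)\<^sup>2)"
    unfolding fock_norm_power2 by (rule integral_complex_of_real)
  finally show ?thesis .
qed

text \<open>The difference is tested against itself. This yields the uniqueness in the weak
  definition of the operator.\<close>

lemma fock_eqI:
  assumes g: "g \<in> fock" and h: "h \<in> fock" and eq: "\<And>f. f \<in> fock \<Longrightarrow> fock_inner g f = fock_inner h f"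
  shows "g = h"
proof -
  let ?d = "\<lambda>w. g w - h w"
  have d: "?d \<in> fock" by (rule fock_diff[OF g h])
  have "fock_inner ?d ?d = 0"
    by (simp add: fock_inner_diff_left[OF g h d] eq[OF d])
  then have "?d = (\<lambda>w. 0)"
    by (intro fock_norm_eq_0_imp[OF d]) (simp add: fock_inner_self)
  then show ?thesis by (simp add: fun_eq_iff)
qed

text \<open>Self-adjointness of \<open>fock_U z\<close>, checked against a basis vector: under the
  reflection \<open>w \<mapsto> z - w\<close> the Gaussian weight times the conjugated kernel turns
  into the weight times the kernel, which is \<open>key\<close>.\<close>

lemma fock_inner_fock_U_basis:
  assumes g: "g \<in> fock"
  shows "fock_inner (fock_U z g) (fock_basis j) = fock_inner g (coherent j z)"
proof -
  have [measurable]: "g \<in> borel_measurable borel" by (rule fock_measurable[OF g])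
  define F where "F w = (exp (- (cmod w)\<^sup>2) / pi) *\<^sub>R (g w * cnj (coherent j z w))" for w
  have [measurable]: "F \<in> borel_measurable borel" unfolding F_def by measurable
  have key: "exp (- complex_of_real ((cmod (z - w))\<^sup>2)) * cnj (exp ((z - w) * cnj z - complex_of_real ((cmod z)\<^sup>2 / 2)))
      = exp (- complex_of_real ((cmod w)\<^sup>2)) * exp (w * cnj z - complex_of_real ((cmod z)\<^sup>2 / 2))" for w
    unfolding exp_cnj exp_add[symmetric]
    by (simp add: complex_norm_square algebra_simps del: of_real_power)
  have eq: "(exp (- (cmod w)\<^sup>2) / pi) *\<^sub>R (fock_U z g w * cnj (fock_basis j w)) = F (z - w)" for w
  proof -
    have "F (z - w) = g (z - w) * cnj (w ^ j / complex_of_real (sqrt (fact j))) / complex_of_real pi *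
        (exp (- complex_of_real ((cmod (z - w))\<^sup>2)) * cnj (exp ((z - w) * cnj z - complex_of_real ((cmod z)\<^sup>2 / 2))))"
      by (simp add: F_def coherent_def scaleR_conv_of_real exp_of_real[symmetric] mult_ac del: of_real_power)
    also have "\<dots> = (exp (- (cmod w)\<^sup>2) / pi) *\<^sub>R (fock_U z g w * cnj (fock_basis j w))"
      unfolding key
      by (simp add: fock_U_def fock_basis_def fock_kernel_def scaleR_conv_of_real exp_of_real[symmetric] mult_ac del: of_real_power)
    finally show ?thesis by simp
  qed
  have [measurable]: "fock_U z g \<in> borel_measurable borel" "fock_basis j \<in> borel_measurable borel"
    unfolding fock_U_def fock_kernel_def fock_basis_def by measurable
  have "fock_inner (fock_U z g) (fock_basis j) = (LINT w|lborel. F (z - w))"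
    unfolding fock_inner_def by (subst integral_gauss) (auto simp: eq)
  also have "\<dots> = (LINT w|lborel. F w)"
    by (rule integral_lborel_reflect) measurable
  also have "\<dots> = fock_inner g (coherent j z)"
    unfolding fock_inner_def F_def by (subst integral_gauss) auto
  finally show ?thesis .
qed

text \<open>After translating by \<open>a\<close>, the integrand becomes the entire function \<open>g (a + v) exp (- v cnj a)\<close>,
  so the mean value property applies.\<close>

lemma fock_reproducing:
  assumes g: "g \<in> fock"
  shows "fock_inner g (fock_kernel a) = exp (- complex_of_real ((cmod a)\<^sup>2 / 2)) * g a"
proof -
  have [measurable]: "g \<in> borel_measurable borel" by (rule fock_measurable[OF g])
  have gh: "g holomorphic_on UNIV" using g by (simp add: fock_def)
  have [measurable]: "fock_kernel a \<in> borel_measurable borel"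
    unfolding fock_kernel_def by measurable
  define F where "F w = (exp (- (cmod w)\<^sup>2) / pi) *\<^sub>R (g w * cnj (fock_kernel a w))" for w
  have [measurable]: "F \<in> borel_measurable borel" unfolding F_def by measurable
  define G where "G v = exp (- complex_of_real ((cmod a)\<^sup>2 / 2)) * (g (a + v) * exp (- v * cnj a))" for v
  have Gh: "G holomorphic_on UNIV"
  proof -
    have "(g \<circ> (\<lambda>v. a + v)) holomorphic_on UNIV"
      by (rule holomorphic_on_compose_gen[OF _ gh]) (auto intro!: holomorphic_intros)
    then show ?thesis unfolding G_def o_def by (intro holomorphic_intros)
  qed
  then have [measurable]: "G \<in> borel_measurable borel"
    by (intro borel_measurable_continuous_onI holomorphic_on_imp_continuous_on)
  have key: "exp (- complex_of_real ((cmod (a + v))\<^sup>2)) * cnj (exp ((a + v) * cnj a - complex_of_real ((cmod a)\<^sup>2 / 2)))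
      = exp (- complex_of_real ((cmod v)\<^sup>2)) * (exp (- complex_of_real ((cmod a)\<^sup>2 / 2)) * exp (- v * cnj a))" for v
    unfolding exp_cnj exp_add[symmetric]
    by (simp add: complex_norm_square algebra_simps del: of_real_power)
  have eq: "F (a + v) = (exp (- (cmod v)\<^sup>2) / pi) *\<^sub>R G v" for v
  proof -
    have "F (a + v) = g (a + v) / complex_of_real pi *
        (exp (- complex_of_real ((cmod (a + v))\<^sup>2)) * cnj (exp ((a + v) * cnj a - complex_of_real ((cmod a)\<^sup>2 / 2))))"
      by (simp add: F_def fock_kernel_def scaleR_conv_of_real exp_of_real[symmetric] del: of_real_power)
    also have "\<dots> = (exp (- (cmod v)\<^sup>2) / pi) *\<^sub>R G v"
      unfolding key by (simp add: G_def scaleR_conv_of_real exp_of_real[symmetric] del: of_real_power)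
    finally show ?thesis .
  qed
  have "integrable lborel F"
    using fock_Cauchy_Schwarz(1)[OF g, of "fock_kernel a"] unfolding F_def fock_kernel_eq_coherent
    by (subst integrable_gauss[symmetric]) (auto simp: coherent_in_fock)
  then have "integrable (distr lborel borel ((+) a)) F"
    by (simp add: lborel_distr_plus)
  then have "integrable lborel (\<lambda>v. F (a + v))"
    by (subst (asm) integrable_distr_eq) auto
  then have "integrable gauss G"
    unfolding eq by (subst integrable_gauss) auto
  then have "G 0 = (LINT v|gauss. G v)"
    using gauss_mean_value[OF Gh] by simp
  also have "\<dots> = (LINT v|lborel. F (a + v))"
    unfolding eq by (rule integral_gauss) measurable
  also have "\<dots> = (LINT w|lborel. F w)"
    by (rule integral_lborel_translate) measurable
  also have "\<dots> = fock_inner g (fock_kernel a)"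
    unfolding fock_inner_def F_def by (subst integral_gauss) auto
  finally show ?thesis by (simp add: G_def)
qed

lemma fock_kernel_in_fock: "fock_kernel a \<in> fock"
  by (simp add: fock_kernel_eq_coherent coherent_in_fock)

lemma fock_norm_kernel: "fock_norm (fock_kernel a) = 1"
proof -
  have "complex_of_real ((fock_norm (fock_kernel a))\<^sup>2) = 1"
    unfolding fock_inner_self[symmetric] fock_reproducing[OF fock_kernel_in_fock] fock_kernel_def exp_add[symmetric]
    by (simp add: complex_norm_square del: of_real_power)
  then have "(fock_norm (fock_kernel a))\<^sup>2 = 1"
    using of_real_eq_1_iff by blast
  then show ?thesis using fock_norm_nonneg[of "fock_kernel a"] by (simp add: power2_eq_1_iff)
qed

text \<open>Cauchy-Schwarz against the normalized kernel at \<open>a\<close>. This is the local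
  bound that makes the unit ball a normal family.\<close>

lemma flat_le_fock_norm:
  assumes "g \<in> fock"
  shows "flat g a \<le> fock_norm g"
  using fock_Cauchy_Schwarz(2)[OF assms fock_kernel_in_fock[of a]]
  by (simp add: fock_reproducing[OF assms] fock_norm_kernel flat_def norm_mult norm_exp_eq_Re mult.commute)

section \<open>The Toeplitz operator as an integral operator\<close>

lemma integrable_dominated:
  fixes F :: "'a \<Rightarrow> 'b::{banach, second_countable_topology}"
  assumes "integrable M D" "F \<in> borel_measurable M" and le: "\<And>x. norm (F x) \<le> D x"
  shows "integrable M F"
  by (rule Bochner_Integration.integrable_bound[OF assms(1,2)]) (auto intro!: AE_I2 order_trans[OF le abs_ge_self])

text \<open>Serves to multiply an estimate by Gaussian weights that cancel the growth factors
  \<open>exp ((cmod w)^2 / 2)\<close> in \<open>b\<close>.\<close>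

lemma ennreal_scale_le:
  assumes "ennreal x \<le> ennreal b * H" "0 \<le> a" "0 \<le> x" "0 \<le> b" "a * x = y" "a * b = c"
  shows "ennreal y \<le> ennreal c * H"
proof -
  have "ennreal a * ennreal x \<le> ennreal a * (ennreal b * H)"
    by (rule mult_left_mono[OF assms(1)]) simp
  also have "\<dots> = (ennreal a * ennreal b) * H" by (simp add: mult.assoc)
  finally show ?thesis
    using assms by (simp only: ennreal_mult[symmetric])
qed

text \<open>Expanding the square leaves a cross term of at most \<open>R * cmod z\<close>, which is
  paid for with half of the Gaussian exponent. One majorant thus serves a whole disc of centres, as
  holomorphy of the images and continuity of the Berezin transform require.\<close>

lemma profile_dominated:
  assumes R: "R \<ge> 0"
  shows "\<exists>K\<ge>0. \<forall>z w. cmod w \<le> R \<longrightarrow> profile j (z - w) \<le> K * exp (- (1 / 4) * (cmod z)\<^sup>2)"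
proof -
  obtain K where K: "K \<ge> 0" "\<And>t::real. t \<ge> 0 \<Longrightarrow> (t + R) ^ j * exp (R * t - (1 / 2) * t\<^sup>2) \<le> K * exp (- ((1 / 2) / 2) * t\<^sup>2)"
    using power_gaussian_bound[of "1/2" R j R] R by auto
  have "profile j (z - w) \<le> K * exp (- (1 / 4) * (cmod z)\<^sup>2)" if w: "cmod w \<le> R" for z w
  proof -
    have "cmod (z - w) ^ j \<le> (cmod z + R) ^ j"
      using norm_triangle_ineq4[of z w] w by (intro power_mono) auto
    moreover have "1 \<le> sqrt (fact j :: real)" by simp
    ultimately have 1: "cmod (z - w) ^ j / sqrt (fact j) \<le> (cmod z + R) ^ j / 1"
      using R by (intro frac_le) auto
    have "Re (w * cnj z) \<le> cmod w * cmod z"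
      using complex_Re_le_cmod[of "w * cnj z"] by (simp add: norm_mult)
    also have "\<dots> \<le> R * cmod z" using w by (intro mult_right_mono) auto
    finally have "- (cmod (z - w))\<^sup>2 / 2 \<le> R * cmod z - (1 / 2) * (cmod z)\<^sup>2"
      unfolding cmod_diff_square using zero_le_power2[of "cmod w"] by argo
    then have 2: "exp (- (cmod (z - w))\<^sup>2 / 2) \<le> exp (R * cmod z - (1 / 2) * (cmod z)\<^sup>2)"
      by simp
    have "profile j (z - w) \<le> (cmod z + R) ^ j * exp (R * cmod z - (1 / 2) * (cmod z)\<^sup>2)"
      unfolding profile_def using 1 2 R by (intro mult_mono) auto
    also have "\<dots> \<le> K * exp (- (1 / 4) * (cmod z)\<^sup>2)"
      using K(2)[of "cmod z"] by simp
    finally show ?thesis .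
  qed
  with K(1) show ?thesis by blast
qed

lemma fock_norm_coherent: "fock_norm (coherent j z) = fock_norm (coherent j 0)"
proof -
  have shift: "(\<integral>\<^sup>+w. (ennreal (profile j (z - w)))\<^sup>2 \<partial>lborel) = (\<integral>\<^sup>+w. (ennreal (profile j w))\<^sup>2 \<partial>lborel)" for z
    by (rule nn_integral_lborel_reflect) measurable
  then have "ennreal pi * ennreal ((fock_norm (coherent j z))\<^sup>2) = ennreal pi * ennreal ((fock_norm (coherent j 0))\<^sup>2)"
    unfolding nn_integral_flat_fock[OF coherent_in_fock, symmetric] flat_coherent by (simp only: shift)
  then show ?thesis
    by (simp add: fock_norm_nonneg flip: ennreal_mult)
qed

section \<open>Convolution with the profile\<close>

text \<open>Valued in \<open>ennreal\<close>, so that Fubini and Schur's test apply before anything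
  is known to be finite.\<close>

definition conv :: "nat \<Rightarrow> (complex \<Rightarrow> ennreal) \<Rightarrow> complex \<Rightarrow> ennreal" where
  "conv j G z = (\<integral>\<^sup>+w. ennreal (profile j (z - w)) * G w \<partial>lborel)"

lemma borel_measurable_conv [measurable]:
  assumes [measurable]: "G \<in> borel_measurable borel"
  shows "conv j G \<in> borel_measurable borel"
  unfolding conv_def by measurable

text \<open>Schur's test for a translation-invariant kernel, whose row and column integrals all
  equal \<open>profile_mass j\<close>.\<close>

lemma Young_conv:
  assumes [measurable]: "G \<in> borel_measurable borel"
  shows "(\<integral>\<^sup>+z. (conv j G z)\<^sup>2 \<partial>lborel) \<le> (profile_mass j)\<^sup>2 * (\<integral>\<^sup>+w. (G w)\<^sup>2 \<partial>lborel)"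
proof -
  have "(\<integral>\<^sup>+z. (conv j G z)\<^sup>2 \<partial>lborel)
      \<le> profile_mass j * (\<integral>\<^sup>+w. (\<integral>\<^sup>+z. ennreal (profile j (z - w)) \<partial>lborel) * (G w)\<^sup>2 \<partial>lborel)"
    unfolding conv_def
    by (rule Schur_test) (auto simp: profile_mass_shift sigma_finite_lborel)
  also have "\<dots> = (profile_mass j)\<^sup>2 * (\<integral>\<^sup>+w. (G w)\<^sup>2 \<partial>lborel)"
    by (simp add: profile_mass_shift nn_integral_cmult power2_eq_square mult.assoc)
  finally show ?thesis .
qed

lemma conv_square_finite:
  assumes [measurable]: "G \<in> borel_measurable borel" and fin: "(\<integral>\<^sup>+w. (G w)\<^sup>2 \<partial>lborel) < \<infinity>"
  shows "(\<integral>\<^sup>+z. (conv j G z)\<^sup>2 \<partial>lborel) < \<infinity>"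
  using Young_conv[of G j] fin profile_mass_finite[of j]
  by (auto simp: ennreal_mult_less_top power_less_top_ennreal intro: le_less_trans)

lemma nn_integral_mult_finite:
  assumes [measurable]: "G \<in> borel_measurable M" "H \<in> borel_measurable M"
    and "(\<integral>\<^sup>+w. (G w)\<^sup>2 \<partial>M) < \<infinity>" "(\<integral>\<^sup>+w. (H w)\<^sup>2 \<partial>M) < \<infinity>"
  shows "(\<integral>\<^sup>+w. G w * H w \<partial>M) < \<infinity>"
proof -
  have "(\<integral>\<^sup>+w. G w * H w \<partial>M)\<^sup>2 \<le> (\<integral>\<^sup>+w. (G w)\<^sup>2 \<partial>M) * (\<integral>\<^sup>+w. (H w)\<^sup>2 \<partial>M)"
    by (rule Cauchy_Schwarz_nn_integral) auto
  also have "\<dots> < \<infinity>" using assms by (simp add: ennreal_mult_less_top)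
  finally show ?thesis by (simp add: power_less_top_ennreal)
qed

lemma flat_fock_finite: "g \<in> fock \<Longrightarrow> (\<integral>\<^sup>+w. (ennreal (flat g w))\<^sup>2 \<partial>lborel) < \<infinity>"
  by (simp add: nn_integral_flat_fock ennreal_mult_less_top)

section \<open>Coefficients with respect to the coherent states\<close>

text \<open>For \<open>g\<close> in \<open>fock\<close> this is the factor
  \<open>fock_inner (fock_U z g) (fock_basis j)\<close> of the weak definition, by
  \<open>fock_inner_fock_U_basis\<close>.\<close>

definition coef :: "nat \<Rightarrow> (complex \<Rightarrow> complex) \<Rightarrow> complex \<Rightarrow> complex" where
  "coef j g z = fock_inner g (coherent j z)"

lemma borel_measurable_coef:
  assumes "g \<in> fock"
  shows "coef j g \<in> borel_measurable borel"
proof -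
  have [measurable]: "g \<in> borel_measurable borel" by (rule fock_measurable[OF assms])
  show ?thesis unfolding coef_def fock_inner_def
    by (rule gauss.borel_measurable_lebesgue_integral) measurable
qed

lemma gauss_density_split: "exp (- (cmod w)\<^sup>2) = exp (- (cmod w)\<^sup>2 / 2) * exp (- (cmod w)\<^sup>2 / 2)"
  by (simp flip: exp_add)

text \<open>Half of the Gaussian exponent goes to \<open>g\<close>, the other half to the coherent
  state, whose weighted modulus is a translate of \<open>profile j\<close>.\<close>

lemma coef_le_conv:
  assumes g: "g \<in> fock"
  shows "ennreal (cmod (coef j g z)) \<le> ennreal (1 / pi) * conv j (\<lambda>w. ennreal (flat g w)) z"
proof -
  have [measurable]: "g \<in> borel_measurable borel" by (rule fock_measurable[OF g])
  have eq: "exp (- (cmod w)\<^sup>2) / pi * cmod (g w * cnj (coherent j z w)) = 1 / pi * (profile j (z - w) * flat g w)" for w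
    unfolding gauss_density_split by (simp add: norm_mult cmod_coherent flat_def exp_minus field_simps)
  have "ennreal (cmod (coef j g z)) \<le> (\<integral>\<^sup>+w. ennreal (cmod (g w * cnj (coherent j z w))) \<partial>gauss)"
    unfolding coef_def fock_inner_def
    by (rule integral_norm_bound_ennreal[OF fock_Cauchy_Schwarz(1)[OF g coherent_in_fock]])
  also have "\<dots> = (\<integral>\<^sup>+w. ennreal (1 / pi) * (ennreal (profile j (z - w)) * ennreal (flat g w)) \<partial>lborel)"
  proof (subst nn_integral_gauss, measurable, rule nn_integral_cong)
    fix w
    show "ennreal (exp (- (cmod w)\<^sup>2) / pi) * ennreal (cmod (g w * cnj (coherent j z w)))
        = ennreal (1 / pi) * (ennreal (profile j (z - w)) * ennreal (flat g w))"
      by (simp only: ennreal_mult[symmetric] eq flat_nonneg profile_nonneg mult_nonneg_nonneg norm_ge_zero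
          divide_nonneg_nonneg exp_ge_zero pi_ge_zero zero_le_one)
  qed
  also have "\<dots> = ennreal (1 / pi) * conv j (\<lambda>w. ennreal (flat g w)) z"
    unfolding conv_def by (rule nn_integral_cmult) measurable
  finally show ?thesis .
qed

lemma coef_square_finite:
  assumes g: "g \<in> fock"
  shows "(\<integral>\<^sup>+z. (ennreal (cmod (coef j g z)))\<^sup>2 \<partial>lborel) < \<infinity>"
proof -
  have [measurable]: "g \<in> borel_measurable borel" by (rule fock_measurable[OF g])
  have "(\<integral>\<^sup>+z. (ennreal (cmod (coef j g z)))\<^sup>2 \<partial>lborel)
      \<le> (\<integral>\<^sup>+z. (ennreal (1 / pi))\<^sup>2 * (conv j (\<lambda>w. ennreal (flat g w)) z)\<^sup>2 \<partial>lborel)"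
    unfolding power_mult_distrib[symmetric]
    by (intro nn_integral_mono power_mono coef_le_conv[OF g]) auto
  also have "\<dots> = (ennreal (1 / pi))\<^sup>2 * (\<integral>\<^sup>+z. (conv j (\<lambda>w. ennreal (flat g w)) z)\<^sup>2 \<partial>lborel)"
    by (rule nn_integral_cmult) measurable
  also have "\<dots> < \<infinity>"
    using conv_square_finite[OF _ flat_fock_finite[OF g], of j]
    by (simp add: ennreal_mult_less_top ennreal_power)
  finally show ?thesis .
qed

lemma coef_bounded:
  assumes g: "g \<in> fock"
  shows "cmod (coef j g z) \<le> fock_norm g * fock_norm (coherent j 0)"
  using fock_Cauchy_Schwarz(2)[OF g coherent_in_fock[of j z]] by (simp add: coef_def fock_norm_coherent[of j z])

lemma coef_add: "g \<in> fock \<Longrightarrow> h \<in> fock \<Longrightarrow> coef j (\<lambda>w. g w + h w) z = coef j g z + coef j h z"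
  by (simp add: coef_def fock_inner_add_left coherent_in_fock)

lemma coef_cmult: "coef j (\<lambda>w. c * g w) z = c * coef j g z"
  by (simp add: coef_def fock_inner_cmult_left)

lemma coef_kernel: "coef j (fock_kernel a) z = exp (- complex_of_real ((cmod a)\<^sup>2 / 2)) * cnj (coherent j z a)"
  unfolding coef_def by (subst fock_inner_cnj) (simp add: fock_reproducing[OF coherent_in_fock] exp_cnj)

section \<open>The operator with a bounded Borel symbol\<close>

text \<open>The bound holds everywhere and not just almost everywhere, so that pointwise majorants
  carry no exceptional sets. Symbols in \<open>Linfty\<close> are reduced to this case at the
  end.\<close>

locale bounded_symbol =
  fixes f :: "complex \<Rightarrow> complex" and C :: real and j :: nat
  assumes f_measurable [measurable]: "f \<in> borel_measurable borel"
    and f_bounded: "\<And>z. cmod (f z) \<le> C"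
begin

lemma C_nonneg: "0 \<le> C"
  using f_bounded[of 0] norm_ge_zero order_trans by blast

text \<open>The vector-valued integral evaluated pointwise: an explicit candidate for the definite
  description in \<open>toeplitz\<close>.\<close>

definition toep :: "(complex \<Rightarrow> complex) \<Rightarrow> complex \<Rightarrow> complex" where
  "toep g w = 1 / complex_of_real pi * (LINT z|lborel. f z * coef j g z * coherent j z w)"

lemma toep_dominated:
  assumes g: "g \<in> fock"
  shows "\<exists>D. integrable lborel D \<and> (\<forall>w z. cmod w \<le> R \<longrightarrow> cmod (f z * coef j g z * coherent j z w) \<le> D z)"
proof (cases "R \<ge> 0")
  case True
  obtain K where K: "K \<ge> 0" "\<And>z w. cmod w \<le> R \<Longrightarrow> profile j (z - w) \<le> K * exp (- (1 / 4) * (cmod z)\<^sup>2)"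
    using profile_dominated[OF True, of j] by blast
  let ?M = "C * (fock_norm g * fock_norm (coherent j 0))"
  let ?D = "\<lambda>z. ?M * (K * exp (- (1 / 4) * (cmod z)\<^sup>2) * exp (R\<^sup>2 / 2))"
  have "cmod (f z * coef j g z * coherent j z w) \<le> ?D z" if w: "cmod w \<le> R" for z w
  proof -
    have "exp ((cmod w)\<^sup>2 / 2) \<le> exp (R\<^sup>2 / 2)" using w by (simp add: power_mono)
    then have "profile j (z - w) * exp ((cmod w)\<^sup>2 / 2) \<le> K * exp (- (1 / 4) * (cmod z)\<^sup>2) * exp (R\<^sup>2 / 2)"
      using K(1) by (intro mult_mono K(2)[OF w]) auto
    moreover have "cmod (f z) * cmod (coef j g z) \<le> ?M"
      by (intro mult_mono f_bounded coef_bounded[OF g] C_nonneg norm_ge_zero)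
    ultimately show ?thesis
      unfolding norm_mult cmod_coherent
      using mult_mono[of "cmod (f z) * cmod (coef j g z)" ?M "profile j (z - w) * exp ((cmod w)\<^sup>2 / 2)"] C_nonneg fock_norm_nonneg
      by simp
  qed
  moreover have "integrable lborel ?D"
    by (intro integrable_mult_right integrable_mult_left integrable_gaussian) simp
  ultimately show ?thesis by blast
next
  \<comment> \<open>No \<open>w\<close> satisfies \<open>cmod w \<le> R\<close>; negative
    \<open>R\<close> occurs because \<open>holomorphic_on_lebesgue_integral\<close> asks for a
    majorant at every \<open>R\<close>.\<close>
  case False
  have "\<not> cmod w \<le> R" for w using norm_ge_zero[of w] False by linarith
  then show ?thesis by (intro exI[of _ "\<lambda>_. 0"]) auto
qed

lemma toep_integrable:
  assumes g: "g \<in> fock"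
  shows "integrable lborel (\<lambda>z. f z * coef j g z * coherent j z w)"
proof -
  have [measurable]: "coef j g \<in> borel_measurable borel" by (rule borel_measurable_coef) fact
  obtain D where D: "integrable lborel D" "\<And>z. cmod (f z * coef j g z * coherent j z w) \<le> D z"
    using toep_dominated[OF g, of "cmod w"] by blast
  show ?thesis by (rule integrable_dominated[OF D(1) _ D(2)]) measurable
qed

lemma toep_holomorphic:
  assumes g: "g \<in> fock"
  shows "toep g holomorphic_on UNIV"
proof -
  have [measurable]: "coef j g \<in> borel_measurable borel" by (rule borel_measurable_coef) fact
  have "(\<lambda>w. LINT z|lborel. f z * coef j g z * coherent j z w) holomorphic_on UNIV"
  proof (rule holomorphic_on_lebesgue_integral)
    show "(\<lambda>w. f z * coef j g z * coherent j z w) holomorphic_on UNIV" for z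
      using holomorphic_coherent[of j z] by (intro holomorphic_intros)
    show "\<exists>D. integrable lborel D \<and> (\<forall>w z. cmod w \<le> R \<longrightarrow> cmod (f z * coef j g z * coherent j z w) \<le> D z)" for R
      by (rule toep_dominated[OF g])
  qed measurable
  then show ?thesis unfolding toep_def by (intro holomorphic_intros)
qed

lemma nn_integral_coef_coherent_le:
  assumes g: "g \<in> fock"
  shows "(\<integral>\<^sup>+z. ennreal (cmod (f z * coef j g z * coherent j z w)) \<partial>lborel)
    \<le> ennreal (C * exp ((cmod w)\<^sup>2 / 2)) * conv j (\<lambda>z. ennreal (cmod (coef j g z))) w"
proof -
  have [measurable]: "coef j g \<in> borel_measurable borel" by (rule borel_measurable_coef) fact
  have "cmod (f z * coef j g z * coherent j z w)
      \<le> C * exp ((cmod w)\<^sup>2 / 2) * (profile j (w - z) * cmod (coef j g z))" for z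
  proof -
    have "cmod (f z) * (cmod (coef j g z) * cmod (coherent j z w))
        \<le> C * (cmod (coef j g z) * cmod (coherent j z w))"
      by (intro mult_right_mono f_bounded) auto
    then show ?thesis
      by (simp add: norm_mult cmod_coherent profile_minus_commute[of j z w] mult_ac)
  qed
  then have "(\<integral>\<^sup>+z. ennreal (cmod (f z * coef j g z * coherent j z w)) \<partial>lborel)
      \<le> (\<integral>\<^sup>+z. ennreal (C * exp ((cmod w)\<^sup>2 / 2)) * (ennreal (profile j (w - z)) * ennreal (cmod (coef j g z))) \<partial>lborel)"
    using C_nonneg by (intro nn_integral_mono) (simp add: ennreal_leI flip: ennreal_mult)
  also have "\<dots> = ennreal (C * exp ((cmod w)\<^sup>2 / 2)) * conv j (\<lambda>z. ennreal (cmod (coef j g z))) w"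
    unfolding conv_def by (rule nn_integral_cmult) measurable
  finally show ?thesis .
qed

lemma conv_coef_finite:
  assumes "g \<in> fock"
  shows "(\<integral>\<^sup>+w. (conv j (\<lambda>z. ennreal (cmod (coef j g z))) w)\<^sup>2 \<partial>lborel) < \<infinity>"
proof -
  have [measurable]: "coef j g \<in> borel_measurable borel" by (rule borel_measurable_coef) fact
  show ?thesis by (rule conv_square_finite[OF _ coef_square_finite[OF assms]]) measurable
qed

text \<open>Young's inequality is used twice: \<open>coef j g\<close> is dominated by a convolution
  of \<open>flat g\<close>, and \<open>flat (toep g)\<close> by a convolution of the modulus of
  \<open>coef j g\<close>.\<close>

lemma toep_in_fock:
  assumes g: "g \<in> fock"
  shows "toep g \<in> fock"
proof (rule fockI[OF toep_holomorphic[OF g]])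
  have [measurable]: "coef j g \<in> borel_measurable borel" by (rule borel_measurable_coef) fact
  let ?H = "conv j (\<lambda>z. ennreal (cmod (coef j g z)))"
  have le: "ennreal (flat (toep g) w) \<le> ennreal (C / pi) * ?H w" for w
  proof -
    have "ennreal (cmod (LINT z|lborel. f z * coef j g z * coherent j z w)) \<le> ennreal (C * exp ((cmod w)\<^sup>2 / 2)) * ?H w"
      by (rule order_trans[OF integral_norm_bound_ennreal[OF toep_integrable[OF g]] nn_integral_coef_coherent_le[OF g]])
    then show ?thesis
    proof (rule ennreal_scale_le)
      show "exp (- (cmod w)\<^sup>2 / 2) / pi * (C * exp ((cmod w)\<^sup>2 / 2)) = C / pi"
        by (simp add: exp_minus field_simps)
      show "exp (- (cmod w)\<^sup>2 / 2) / pi * cmod (LINT z|lborel. f z * coef j g z * coherent j z w) = flat (toep g) w"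
        by (simp add: flat_def toep_def norm_mult norm_divide)
    qed (use C_nonneg in auto)
  qed
  have "(\<integral>\<^sup>+w. (ennreal (flat (toep g) w))\<^sup>2 \<partial>lborel) \<le> (\<integral>\<^sup>+w. (ennreal (C / pi))\<^sup>2 * (?H w)\<^sup>2 \<partial>lborel)"
    unfolding power_mult_distrib[symmetric] by (intro nn_integral_mono power_mono le) auto
  also have "\<dots> = (ennreal (C / pi))\<^sup>2 * (\<integral>\<^sup>+w. (?H w)\<^sup>2 \<partial>lborel)"
    by (rule nn_integral_cmult) measurable
  also have "\<dots> < \<infinity>"
    using conv_coef_finite[OF g] C_nonneg by (simp add: ennreal_mult_less_top ennreal_power)
  finally show "(\<integral>\<^sup>+w. (ennreal (flat (toep g) w))\<^sup>2 \<partial>lborel) < \<infinity>" .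
qed

text \<open>Fubini, with absolute convergence from Cauchy-Schwarz for \<open>flat h\<close> and the
  convolution of the coefficients of \<open>g\<close>, both square integrable.\<close>

lemma fock_inner_toep:
  assumes g: "g \<in> fock" and h: "h \<in> fock"
  shows "fock_inner (toep g) h = 1 / complex_of_real pi * (LINT z|lborel. f z * coef j g z * cnj (coef j h z))"
proof -
  have [measurable]: "coef j g \<in> borel_measurable borel" "h \<in> borel_measurable borel"
    by (rule borel_measurable_coef fock_measurable; fact)+
  interpret P: pair_sigma_finite gauss lborel ..
  let ?\<Psi> = "\<lambda>w z. f z * coef j g z * coherent j z w * cnj (h w)"
  let ?H = "conv j (\<lambda>z. ennreal (cmod (coef j g z)))"
  have int: "integrable (gauss \<Otimes>\<^sub>M lborel) (\<lambda>(w, z). ?\<Psi> w z)"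
  proof (rule integrableI_bounded)
    have "(\<integral>\<^sup>+p. ennreal (norm (case p of (w, z) \<Rightarrow> ?\<Psi> w z)) \<partial>(gauss \<Otimes>\<^sub>M lborel))
        = (\<integral>\<^sup>+w. (\<integral>\<^sup>+z. ennreal (cmod (h w)) * ennreal (cmod (f z * coef j g z * coherent j z w)) \<partial>lborel) \<partial>gauss)"
      by (subst lborel.nn_integral_fst[symmetric]) (auto simp: norm_mult mult_ac simp flip: ennreal_mult)
    also have "\<dots> = (\<integral>\<^sup>+w. ennreal (cmod (h w)) * (\<integral>\<^sup>+z. ennreal (cmod (f z * coef j g z * coherent j z w)) \<partial>lborel) \<partial>gauss)"
      by (intro nn_integral_cong nn_integral_cmult) measurable
    also have "\<dots> \<le> (\<integral>\<^sup>+w. ennreal (cmod (h w)) * (ennreal (C * exp ((cmod w)\<^sup>2 / 2)) * ?H w) \<partial>gauss)"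
      by (intro nn_integral_mono mult_left_mono nn_integral_coef_coherent_le[OF g]) auto
    also have "\<dots> = (\<integral>\<^sup>+w. ennreal (C / pi) * (ennreal (flat h w) * ?H w) \<partial>lborel)"
    proof (subst nn_integral_gauss, measurable, rule nn_integral_cong)
      fix w
      have "exp (- (cmod w)\<^sup>2) / pi * cmod (h w) * (C * exp ((cmod w)\<^sup>2 / 2)) = C / pi * flat h w"
        unfolding gauss_density_split by (simp add: flat_def exp_minus field_simps)
      then have "ennreal (exp (- (cmod w)\<^sup>2) / pi) * ennreal (cmod (h w)) * ennreal (C * exp ((cmod w)\<^sup>2 / 2))
          = ennreal (C / pi) * ennreal (flat h w)"
        using C_nonneg by (simp flip: ennreal_mult)
      then show "ennreal (exp (- (cmod w)\<^sup>2) / pi) * (ennreal (cmod (h w)) * (ennreal (C * exp ((cmod w)\<^sup>2 / 2)) * ?H w))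
          = ennreal (C / pi) * (ennreal (flat h w) * ?H w)"
        by (simp add: mult.assoc[symmetric])
    qed
    also have "\<dots> = ennreal (C / pi) * (\<integral>\<^sup>+w. ennreal (flat h w) * ?H w \<partial>lborel)"
      by (rule nn_integral_cmult) measurable
    also have "\<dots> < \<infinity>"
      using nn_integral_mult_finite[OF _ _ flat_fock_finite[OF h] conv_coef_finite[OF g]]
      by (simp add: ennreal_mult_less_top)
    finally show "(\<integral>\<^sup>+p. ennreal (norm (case p of (w, z) \<Rightarrow> ?\<Psi> w z)) \<partial>(gauss \<Otimes>\<^sub>M lborel)) < \<infinity>" .
  qed measurable
  have "fock_inner (toep g) h = (LINT w|gauss. 1 / complex_of_real pi * (LINT z|lborel. ?\<Psi> w z))"
    unfolding fock_inner_def toep_def by (simp add: toep_integrable[OF g])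
  also have "\<dots> = 1 / complex_of_real pi * (LINT w|gauss. (LINT z|lborel. ?\<Psi> w z))"
    by (rule integral_mult_right_zero)
  also have "(LINT w|gauss. (LINT z|lborel. ?\<Psi> w z)) = (LINT z|lborel. (LINT w|gauss. ?\<Psi> w z))"
    by (rule P.Fubini_integral[OF int, symmetric])
  also have "\<dots> = (LINT z|lborel. f z * coef j g z * cnj (coef j h z))"
  proof (rule Bochner_Integration.integral_cong[OF refl])
    fix z
    have "(LINT w|gauss. ?\<Psi> w z) = (LINT w|gauss. (f z * coef j g z) * (coherent j z w * cnj (h w)))"
      by (simp add: mult.assoc)
    also have "\<dots> = f z * coef j g z * fock_inner (coherent j z) h"
      unfolding fock_inner_def by (rule integral_mult_right_zero)
    finally show "(LINT w|gauss. ?\<Psi> w z) = f z * coef j g z * cnj (coef j h z)"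
      by (simp add: coef_def fock_inner_cnj[of "coherent j z" h])
  qed
  finally show ?thesis .
qed

lemma fock_linear_toep: "fock_linear toep"
  unfolding fock_linear_def
proof (intro conjI ballI allI)
  fix g h assume gh: "g \<in> fock" "h \<in> fock"
  show "toep (\<lambda>w. g w + h w) = (\<lambda>w. toep g w + toep h w)"
    unfolding toep_def coef_add[OF gh]
    by (simp add: distrib_left distrib_right toep_integrable gh add_divide_distrib fun_eq_iff)
next
  fix c g
  show "toep (\<lambda>w. c * g w) = (\<lambda>w. c * toep g w)"
    unfolding toep_def coef_cmult
    by (simp add: mult.left_commute[of _ c] mult.assoc fun_eq_iff)
qed (rule toep_in_fock)

section \<open>The integral kernel and its Schur estimate\<close>

text \<open>The factor \<open>1 / pi\<close> of the operator is kept outside and reappears in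
  \<open>toep_eq_kernel\<close>.\<close>

definition toep_kernel :: "complex \<Rightarrow> complex \<Rightarrow> complex" where
  "toep_kernel w u = (LINT z|lborel. f z * cnj (coherent j z u) * coherent j z w)"

text \<open>Each variable receives half of the Gaussian exponent, so that this kernel maps
  \<open>flat g\<close> to a bound for \<open>flat (toep g)\<close> with respect to
  \<open>lborel\<close>.\<close>

definition flat_kernel :: "complex \<Rightarrow> complex \<Rightarrow> real" where
  "flat_kernel w u = cmod (toep_kernel w u) * exp (- (cmod w)\<^sup>2 / 2) * exp (- (cmod u)\<^sup>2 / 2)"

lemma toep_kernel_measurable [measurable]: "(\<lambda>(w, u). toep_kernel w u) \<in> borel_measurable (borel \<Otimes>\<^sub>M borel)"
  unfolding toep_kernel_def case_prod_beta
  by (rule lborel.borel_measurable_lebesgue_integral) measurable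

lemma flat_kernel_measurable [measurable]: "(\<lambda>(w, u). flat_kernel w u) \<in> borel_measurable (borel \<Otimes>\<^sub>M borel)"
  unfolding flat_kernel_def by measurable

lemma flat_kernel_nonneg [simp]: "0 \<le> flat_kernel w u"
  by (simp add: flat_kernel_def)

lemma nn_integral_kernel_le:
  "(\<integral>\<^sup>+z. ennreal (cmod (f z * cnj (coherent j z u) * coherent j z w)) \<partial>lborel)
    \<le> ennreal (C * exp ((cmod w)\<^sup>2 / 2) * exp ((cmod u)\<^sup>2 / 2)) * conv j (\<lambda>z. ennreal (profile j (z - w))) u"
proof -
  have "cmod (f z * cnj (coherent j z u) * coherent j z w)
      \<le> C * exp ((cmod w)\<^sup>2 / 2) * exp ((cmod u)\<^sup>2 / 2) * (profile j (u - z) * profile j (z - w))" for z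
  proof -
    have "cmod (f z) * (cmod (coherent j z u) * cmod (coherent j z w))
        \<le> C * (cmod (coherent j z u) * cmod (coherent j z w))"
      by (intro mult_right_mono f_bounded) auto
    then show ?thesis
      by (simp add: norm_mult cmod_coherent profile_minus_commute[of j z u] mult_ac)
  qed
  then have "(\<integral>\<^sup>+z. ennreal (cmod (f z * cnj (coherent j z u) * coherent j z w)) \<partial>lborel)
      \<le> (\<integral>\<^sup>+z. ennreal (C * exp ((cmod w)\<^sup>2 / 2) * exp ((cmod u)\<^sup>2 / 2)) * (ennreal (profile j (u - z)) * ennreal (profile j (z - w))) \<partial>lborel)"
    using C_nonneg by (intro nn_integral_mono) (simp add: ennreal_leI flip: ennreal_mult)
  also have "\<dots> = ennreal (C * exp ((cmod w)\<^sup>2 / 2) * exp ((cmod u)\<^sup>2 / 2)) * conv j (\<lambda>z. ennreal (profile j (z - w))) u"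
    unfolding conv_def by (rule nn_integral_cmult) measurable
  finally show ?thesis .
qed

lemma profile_square_finite: "(\<integral>\<^sup>+z. (ennreal (profile j (z - w)))\<^sup>2 \<partial>lborel) < \<infinity>"
  using flat_fock_finite[OF coherent_in_fock[of j w]]
  by (simp add: flat_coherent profile_minus_commute[of j w])

text \<open>Fubini again; absolute convergence is now Cauchy-Schwarz for \<open>flat g\<close> and
  the convolution of a profile with a translated profile.\<close>

lemma toep_eq_kernel:
  assumes g: "g \<in> fock"
  shows "toep g w = 1 / complex_of_real pi * (LINT u|gauss. g u * toep_kernel w u)"
proof -
  have [measurable]: "g \<in> borel_measurable borel" using g by (rule fock_measurable)
  interpret P: pair_sigma_finite gauss lborel ..
  let ?\<Psi> = "\<lambda>u z. g u * (f z * cnj (coherent j z u) * coherent j z w)"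
  let ?H = "conv j (\<lambda>z. ennreal (profile j (z - w)))"
  have int: "integrable (gauss \<Otimes>\<^sub>M lborel) (\<lambda>(u, z). ?\<Psi> u z)"
  proof (rule integrableI_bounded)
    have "(\<integral>\<^sup>+p. ennreal (norm (case p of (u, z) \<Rightarrow> ?\<Psi> u z)) \<partial>(gauss \<Otimes>\<^sub>M lborel))
        = (\<integral>\<^sup>+u. (\<integral>\<^sup>+z. ennreal (cmod (g u)) * ennreal (cmod (f z * cnj (coherent j z u) * coherent j z w)) \<partial>lborel) \<partial>gauss)"
      by (subst lborel.nn_integral_fst[symmetric]) (auto simp: norm_mult simp flip: ennreal_mult)
    also have "\<dots> = (\<integral>\<^sup>+u. ennreal (cmod (g u)) * (\<integral>\<^sup>+z. ennreal (cmod (f z * cnj (coherent j z u) * coherent j z w)) \<partial>lborel) \<partial>gauss)"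
      by (intro nn_integral_cong nn_integral_cmult) measurable
    also have "\<dots> \<le> (\<integral>\<^sup>+u. ennreal (cmod (g u)) * (ennreal (C * exp ((cmod w)\<^sup>2 / 2) * exp ((cmod u)\<^sup>2 / 2)) * ?H u) \<partial>gauss)"
      by (intro nn_integral_mono mult_left_mono nn_integral_kernel_le) auto
    also have "\<dots> = (\<integral>\<^sup>+u. ennreal (C * exp ((cmod w)\<^sup>2 / 2) / pi) * (ennreal (flat g u) * ?H u) \<partial>lborel)"
    proof (subst nn_integral_gauss, measurable, rule nn_integral_cong)
      fix u
      have "exp (- (cmod u)\<^sup>2) / pi * cmod (g u) * (C * exp ((cmod w)\<^sup>2 / 2) * exp ((cmod u)\<^sup>2 / 2)) = C * exp ((cmod w)\<^sup>2 / 2) / pi * flat g u"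
        unfolding gauss_density_split by (simp add: flat_def exp_minus field_simps)
      then have "ennreal (exp (- (cmod u)\<^sup>2) / pi) * ennreal (cmod (g u)) * ennreal (C * exp ((cmod w)\<^sup>2 / 2) * exp ((cmod u)\<^sup>2 / 2))
          = ennreal (C * exp ((cmod w)\<^sup>2 / 2) / pi) * ennreal (flat g u)"
        using C_nonneg by (simp flip: ennreal_mult)
      then show "ennreal (exp (- (cmod u)\<^sup>2) / pi) * (ennreal (cmod (g u)) * (ennreal (C * exp ((cmod w)\<^sup>2 / 2) * exp ((cmod u)\<^sup>2 / 2)) * ?H u))
          = ennreal (C * exp ((cmod w)\<^sup>2 / 2) / pi) * (ennreal (flat g u) * ?H u)"
        by (simp only: mult.assoc[symmetric])
    qed
    also have "\<dots> = ennreal (C * exp ((cmod w)\<^sup>2 / 2) / pi) * (\<integral>\<^sup>+u. ennreal (flat g u) * ?H u \<partial>lborel)"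
      by (rule nn_integral_cmult) measurable
    also have "\<dots> < \<infinity>"
      using nn_integral_mult_finite[OF _ _ flat_fock_finite[OF g] conv_square_finite[OF _ profile_square_finite[of w], of j]]
      by (simp add: ennreal_mult_less_top)
    finally show "(\<integral>\<^sup>+p. ennreal (norm (case p of (u, z) \<Rightarrow> ?\<Psi> u z)) \<partial>(gauss \<Otimes>\<^sub>M lborel)) < \<infinity>" .
  qed measurable
  have "toep g w = 1 / complex_of_real pi * (LINT z|lborel. (LINT u|gauss. ?\<Psi> u z))"
  proof -
    have "f z * coef j g z * coherent j z w = (LINT u|gauss. ?\<Psi> u z)" for z
    proof -
      have "(LINT u|gauss. ?\<Psi> u z) = (LINT u|gauss. (f z * coherent j z w) * (g u * cnj (coherent j z u)))"
        by (simp add: mult_ac)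
      also have "\<dots> = f z * coherent j z w * coef j g z"
        unfolding coef_def fock_inner_def by (rule integral_mult_right_zero)
      finally have "f z * coherent j z w * coef j g z = (LINT u|gauss. ?\<Psi> u z)" by (rule sym)
      then show ?thesis by (simp only: mult_ac)
    qed
    then show ?thesis by (simp add: toep_def)
  qed
  also have "(LINT z|lborel. (LINT u|gauss. ?\<Psi> u z)) = (LINT u|gauss. (LINT z|lborel. ?\<Psi> u z))"
    by (rule P.Fubini_integral[OF int])
  also have "\<dots> = (LINT u|gauss. g u * toep_kernel w u)"
    unfolding toep_kernel_def by (intro Bochner_Integration.integral_cong[OF refl] integral_mult_right_zero)
  finally show ?thesis .
qed

lemma flat_kernel_le: "ennreal (flat_kernel w u) \<le> ennreal C * conv j (\<lambda>z. ennreal (profile j (z - w))) u"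
proof -
  let ?I = "LINT z|lborel. f z * cnj (coherent j z u) * coherent j z w"
  let ?H = "conv j (\<lambda>z. ennreal (profile j (z - w))) u"
  have *: "ennreal (cmod ?I) \<le> ennreal (C * exp ((cmod w)\<^sup>2 / 2) * exp ((cmod u)\<^sup>2 / 2)) * ?H"
  proof (cases "integrable lborel (\<lambda>z. f z * cnj (coherent j z u) * coherent j z w)")
    case True
    show ?thesis by (rule order_trans[OF integral_norm_bound_ennreal[OF True] nn_integral_kernel_le])
  \<comment> \<open>A divergent integral has the default value 0, for which the bound is
    trivial.\<close>
  qed (simp add: not_integrable_integral_eq)
  show ?thesis
  proof (rule ennreal_scale_le[OF *])
    show "exp (- (cmod w)\<^sup>2 / 2) * exp (- (cmod u)\<^sup>2 / 2) * (C * exp ((cmod w)\<^sup>2 / 2) * exp ((cmod u)\<^sup>2 / 2)) = C"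
      by (simp add: exp_minus field_simps)
    show "exp (- (cmod w)\<^sup>2 / 2) * exp (- (cmod u)\<^sup>2 / 2) * cmod ?I = flat_kernel w u"
      by (simp add: flat_kernel_def toep_kernel_def)
  qed (use C_nonneg in auto)
qed

lemma nn_integral_conv_profile: "(\<integral>\<^sup>+u. conv j (\<lambda>z. ennreal (profile j (z - w))) u \<partial>lborel) = (profile_mass j)\<^sup>2"
proof -
  have "(\<integral>\<^sup>+u. conv j (\<lambda>z. ennreal (profile j (z - w))) u \<partial>lborel)
      = (\<integral>\<^sup>+z. (\<integral>\<^sup>+u. ennreal (profile j (u - z)) * ennreal (profile j (z - w)) \<partial>lborel) \<partial>lborel)"
    unfolding conv_def by (rule lborel_pair.Fubini'[symmetric]) measurable
  also have "\<dots> = (\<integral>\<^sup>+z. profile_mass j * ennreal (profile j (z - w)) \<partial>lborel)"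
    by (simp add: nn_integral_multc profile_mass_shift)
  also have "\<dots> = (profile_mass j)\<^sup>2"
    by (simp add: nn_integral_cmult profile_mass_shift power2_eq_square)
  finally show ?thesis .
qed

definition column_mass :: "complex \<Rightarrow> ennreal" where
  "column_mass u = (\<integral>\<^sup>+w. ennreal (flat_kernel w u) \<partial>lborel)"

lemma column_mass_measurable [measurable]: "column_mass \<in> borel_measurable borel"
  unfolding column_mass_def by (rule lborel.borel_measurable_nn_integral) measurable

lemma toep_norm_estimate:
  assumes g: "g \<in> fock"
  shows "ennreal ((fock_norm (toep g))\<^sup>2)
    \<le> ennreal C * (profile_mass j)\<^sup>2 * (\<integral>\<^sup>+u. column_mass u * (ennreal (flat g u))\<^sup>2 \<partial>lborel)"
proof -
  have [measurable]: "g \<in> borel_measurable borel" using g by (rule fock_measurable)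
  have le: "ennreal (flat (toep g) w) \<le> (\<integral>\<^sup>+u. ennreal (flat_kernel w u) * ennreal (flat g u) \<partial>lborel)" for w
  proof -
    have eq: "exp (- (cmod w)\<^sup>2 / 2) * (exp (- (cmod u)\<^sup>2) / pi * cmod (g u * toep_kernel w u)) = 1 / pi * (flat_kernel w u * flat g u)" for u
      unfolding gauss_density_split by (simp add: norm_mult flat_kernel_def flat_def)
    have "ennreal (cmod (LINT u|gauss. g u * toep_kernel w u)) \<le> (\<integral>\<^sup>+u. ennreal (cmod (g u * toep_kernel w u)) \<partial>gauss)"
    proof (cases "integrable gauss (\<lambda>u. g u * toep_kernel w u)")
      case True
      then show ?thesis by (rule integral_norm_bound_ennreal)
    qed (simp add: not_integrable_integral_eq)
    then have "ennreal (exp (- (cmod w)\<^sup>2 / 2)) * ennreal (cmod (LINT u|gauss. g u * toep_kernel w u))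
        \<le> ennreal (exp (- (cmod w)\<^sup>2 / 2)) * (\<integral>\<^sup>+u. ennreal (cmod (g u * toep_kernel w u)) \<partial>gauss)"
      by (rule mult_left_mono) simp
    also have "\<dots> = (\<integral>\<^sup>+u. ennreal (exp (- (cmod w)\<^sup>2 / 2)) * (ennreal (exp (- (cmod u)\<^sup>2) / pi) * ennreal (cmod (g u * toep_kernel w u))) \<partial>lborel)"
      by (subst nn_integral_gauss, measurable, rule nn_integral_cmult[symmetric]) measurable
    also have "\<dots> = (\<integral>\<^sup>+u. ennreal (1 / pi * (flat_kernel w u * flat g u)) \<partial>lborel)"
      by (simp only: ennreal_mult[symmetric] eq flat_nonneg mult_nonneg_nonneg norm_ge_zero
          divide_nonneg_nonneg exp_ge_zero pi_ge_zero)
    also have "\<dots> \<le> (\<integral>\<^sup>+u. ennreal (flat_kernel w u) * ennreal (flat g u) \<partial>lborel)"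
    proof (intro nn_integral_mono)
      fix u
      \<comment> \<open>This \<open>1 / pi\<close> is estimated above by 1, and so is the one in
        \<open>toep_eq_kernel\<close>; the \<open>pi\<close> in front of the squared norm is
        estimated below by 1. Exact constants are irrelevant for compactness.\<close>
      have "1 / pi * (flat_kernel w u * flat g u) \<le> 1 * (flat_kernel w u * flat g u)"
        using pi_gt3 by (intro mult_right_mono) auto
      then show "ennreal (1 / pi * (flat_kernel w u * flat g u)) \<le> ennreal (flat_kernel w u) * ennreal (flat g u)"
        by (simp add: ennreal_leI flip: ennreal_mult)
    qed
    finally have 1: "ennreal (exp (- (cmod w)\<^sup>2 / 2) * cmod (LINT u|gauss. g u * toep_kernel w u))
        \<le> (\<integral>\<^sup>+u. ennreal (flat_kernel w u) * ennreal (flat g u) \<partial>lborel)"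
      by (simp add: ennreal_mult)
    have "flat (toep g) w = 1 / pi * (exp (- (cmod w)\<^sup>2 / 2) * cmod (LINT u|gauss. g u * toep_kernel w u))"
      by (simp add: flat_def toep_eq_kernel[OF g] norm_mult norm_divide)
    also have "\<dots> \<le> 1 * (exp (- (cmod w)\<^sup>2 / 2) * cmod (LINT u|gauss. g u * toep_kernel w u))"
      using pi_gt3 by (intro mult_right_mono) auto
    finally show ?thesis
      by (intro order_trans[OF ennreal_leI 1]) (simp only: mult_1)
  qed
  have "ennreal ((fock_norm (toep g))\<^sup>2) \<le> ennreal pi * ennreal ((fock_norm (toep g))\<^sup>2)"
    using mult_right_mono[of 1 pi "(fock_norm (toep g))\<^sup>2"] pi_gt3
    by (simp add: ennreal_leI flip: ennreal_mult)
  also have "\<dots> = (\<integral>\<^sup>+w. (ennreal (flat (toep g) w))\<^sup>2 \<partial>lborel)"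
    by (rule nn_integral_flat_fock[OF toep_in_fock[OF g], symmetric])
  also have "\<dots> \<le> (\<integral>\<^sup>+w. (\<integral>\<^sup>+u. ennreal (flat_kernel w u) * ennreal (flat g u) \<partial>lborel)\<^sup>2 \<partial>lborel)"
    by (intro nn_integral_mono power_mono le) auto
  also have "\<dots> \<le> (ennreal C * (profile_mass j)\<^sup>2) * (\<integral>\<^sup>+u. (\<integral>\<^sup>+w. ennreal (flat_kernel w u) \<partial>lborel) * (ennreal (flat g u))\<^sup>2 \<partial>lborel)"
  \<comment> \<open>The uniform row bound is the bound on the symbol times the total mass of a
    convolution of two profiles.\<close>
  proof (rule Schur_test)
    show "(\<integral>\<^sup>+u. ennreal (flat_kernel w u) \<partial>lborel) \<le> ennreal C * (profile_mass j)\<^sup>2" for w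
    proof -
      have "(\<integral>\<^sup>+u. ennreal (flat_kernel w u) \<partial>lborel) \<le> (\<integral>\<^sup>+u. ennreal C * conv j (\<lambda>z. ennreal (profile j (z - w))) u \<partial>lborel)"
        by (intro nn_integral_mono flat_kernel_le)
      also have "\<dots> = ennreal C * (profile_mass j)\<^sup>2"
        by (subst nn_integral_cmult) (auto simp: nn_integral_conv_profile)
      finally show ?thesis .
    qed
  qed (auto simp: sigma_finite_lborel)
  finally show ?thesis by (simp add: column_mass_def)
qed

end

section \<open>Off-diagonal decay\<close>

context bounded_symbol
begin

text \<open>Both coefficients in the weak formula come from the kernel at \<open>a\<close> and have
  modulus \<open>profile j (z - a)\<close>; the Berezin transform is thus a convolution of the
  symbol with a Gaussian-type weight.\<close>

lemma berezin_toep: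
  "berezin toep a = 1 / complex_of_real pi * (LINT z|lborel. f z * complex_of_real ((profile j (z - a))\<^sup>2))"
proof -
  have "coef j (fock_kernel a) z * cnj (coef j (fock_kernel a) z) = complex_of_real ((profile j (z - a))\<^sup>2)" for z
  proof -
    have 1: "cmod (exp (- complex_of_real r)) = exp (- r)" for r
      by (simp add: norm_exp_eq_Re)
    have "cmod (coef j (fock_kernel a) z) = profile j (z - a)"
      unfolding coef_kernel norm_mult 1 complex_mod_cnj cmod_coherent by (simp add: exp_minus)
    then show ?thesis by (metis complex_norm_square)
  qed
  then show ?thesis
    unfolding berezin_def fock_inner_toep[OF fock_kernel_in_fock fock_kernel_in_fock]
    by (simp only: mult.assoc)
qed

section \<open>Polarization of the Berezin transform\<close>

text \<open>For real \<open>s\<close> the two parameters \<open>p = (b/2)(1 + is)\<close> and \<open>q = (cnj b/2)(1 - is)\<close> are conjugate to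
  each other and the integral is a value of the Berezin transform; at \<open>s = -i\<close> they are \<open>b\<close> and \<open>0\<close>,
  and it becomes the off-diagonal kernel entry at \<open>(u + b, u)\<close>.\<close>

definition polarized_integrand :: "complex \<Rightarrow> complex \<Rightarrow> complex \<Rightarrow> complex" where
  "polarized_integrand p q z = (z - p) ^ j * (cnj z - q) ^ j * exp (p * cnj z + q * z - z * cnj z)"

definition polarized :: "complex \<Rightarrow> complex \<Rightarrow> complex \<Rightarrow> complex" where
  "polarized b u s = (LINT z|lborel. f (u + z) *
     polarized_integrand (b / 2 * (1 + \<i> * s)) (cnj b / 2 * (1 - \<i> * s)) z)"

lemma polarized_integrand_measurable [measurable]: "polarized_integrand p q \<in> borel_measurable borel"
  unfolding polarized_integrand_def by measurable

text \<open>Each linear exponent contributes at most \<open>P * cmod z\<close> and each power at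
  most \<open>(cmod z + P) ^ j\<close>. Hence the parameters \<open>2 * P\<close> and
  \<open>j + j\<close>, paid for with half of the Gaussian exponent.\<close>

lemma polarized_integrand_dominated:
  assumes P: "P \<ge> 0"
  shows "\<exists>K\<ge>0. \<forall>p q z. cmod p \<le> P \<longrightarrow> cmod q \<le> P \<longrightarrow> cmod (polarized_integrand p q z) \<le> K * exp (- (1 / 2) * (cmod z)\<^sup>2)"
proof -
  obtain K where K: "K \<ge> 0" "\<And>t::real. t \<ge> 0 \<Longrightarrow> (t + P) ^ (j + j) * exp ((2 * P) * t - 1 * t\<^sup>2) \<le> K * exp (- (1 / 2) * t\<^sup>2)"
    using power_gaussian_bound[of 1 P "j + j" "2 * P"] P by auto
  have "cmod (polarized_integrand p q z) \<le> K * exp (- (1 / 2) * (cmod z)\<^sup>2)" if p: "cmod p \<le> P" and q: "cmod q \<le> P" for p q z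
  proof -
    have 1: "cmod (z - p) ^ j \<le> (cmod z + P) ^ j"
      using norm_triangle_ineq4[of z p] p by (intro power_mono) auto
    have 2: "cmod (cnj z - q) ^ j \<le> (cmod z + P) ^ j"
      using norm_triangle_ineq4[of "cnj z" q] q by (intro power_mono) auto
    have "Re (p * cnj z) \<le> P * cmod z"
      using complex_Re_le_cmod[of "p * cnj z"] mult_right_mono[OF p, of "cmod z"] by (simp add: norm_mult)
    moreover have "Re (q * z) \<le> P * cmod z"
      using complex_Re_le_cmod[of "q * z"] mult_right_mono[OF q, of "cmod z"] by (simp add: norm_mult)
    moreover have "Re (z * cnj z) = (cmod z)\<^sup>2"
      by (metis Re_complex_of_real complex_norm_square)
    ultimately have "Re (p * cnj z + q * z - z * cnj z) \<le> (2 * P) * cmod z - 1 * (cmod z)\<^sup>2"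
      unfolding minus_complex.sel plus_complex.sel by linarith
    then have 3: "cmod (exp (p * cnj z + q * z - z * cnj z)) \<le> exp ((2 * P) * cmod z - 1 * (cmod z)\<^sup>2)"
      by (simp only: norm_exp_eq_Re exp_le_cancel_iff)
    have "cmod (polarized_integrand p q z) \<le> (cmod z + P) ^ j * (cmod z + P) ^ j * exp ((2 * P) * cmod z - 1 * (cmod z)\<^sup>2)"
      unfolding polarized_integrand_def norm_mult norm_power using P
      by (intro mult_mono 1 2 3) auto
    also have "\<dots> \<le> K * exp (- (1 / 2) * (cmod z)\<^sup>2)"
      using K(2)[of "cmod z"] by (simp add: power_add)
    finally show ?thesis .
  qed
  with K(1) show ?thesis by blast
qed

text \<open>The symbol enters only through \<open>C\<close>, so one majorant serves all
  \<open>u\<close>. It gives both the holomorphy in \<open>s\<close> and the bound uniform in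
  \<open>u\<close> that normality requires.\<close>

lemma polarized_dominated:
  "\<exists>D. integrable lborel D \<and> (\<forall>u s z. cmod s \<le> R \<longrightarrow>
     cmod (f (u + z) * polarized_integrand (b / 2 * (1 + \<i> * s)) (cnj b / 2 * (1 - \<i> * s)) z) \<le> D z)"
proof -
  \<comment> \<open>From \<open>cmod (1 \<plusminus> \<i> * s) \<le> 1 + \<bar>R\<bar>\<close>, with
    the factor 1/2 given away.\<close>
  define P where "P = cmod b * (1 + \<bar>R\<bar>)"
  have P0: "P \<ge> 0" by (simp add: P_def)
  obtain K where K: "K \<ge> 0" "\<And>p q z. cmod p \<le> P \<Longrightarrow> cmod q \<le> P \<Longrightarrow> cmod (polarized_integrand p q z) \<le> K * exp (- (1 / 2) * (cmod z)\<^sup>2)"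
    using polarized_integrand_dominated[OF P0] by blast
  have "cmod (f (u + z) * polarized_integrand (b / 2 * (1 + \<i> * s)) (cnj b / 2 * (1 - \<i> * s)) z) \<le> C * (K * exp (- (1 / 2) * (cmod z)\<^sup>2))"
    if s: "cmod s \<le> R" for u s z
  proof -
    have "cmod (1 + \<i> * s) \<le> 1 + \<bar>R\<bar>" "cmod (1 - \<i> * s) \<le> 1 + \<bar>R\<bar>"
      using s norm_triangle_ineq[of 1 "\<i> * s"] norm_triangle_ineq4[of 1 "\<i> * s"] by (auto simp: norm_mult)
    moreover have "cmod (b / 2) \<le> cmod b" "cmod (cnj b / 2) \<le> cmod b"
      by (simp_all add: norm_divide)
    ultimately have "cmod (b / 2 * (1 + \<i> * s)) \<le> P" "cmod (cnj b / 2 * (1 - \<i> * s)) \<le> P"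
      unfolding P_def norm_mult[of "b / 2"] norm_mult[of "cnj b / 2"]
      by (blast intro: mult_mono norm_ge_zero)+
    then show ?thesis
      unfolding norm_mult[of "f _"] by (intro mult_mono f_bounded K C_nonneg norm_ge_zero)
  qed
  moreover have "integrable lborel (\<lambda>z::complex. C * (K * exp (- (1 / 2) * (cmod z)\<^sup>2)))"
    by (intro integrable_mult_right integrable_gaussian) simp
  ultimately show ?thesis by blast
qed

lemma polarized_holomorphic: "polarized b u holomorphic_on UNIV"
proof -
  have "(\<lambda>s. LINT z|lborel. f (u + z) * polarized_integrand (b / 2 * (1 + \<i> * s)) (cnj b / 2 * (1 - \<i> * s)) z) holomorphic_on UNIV"
  proof (rule holomorphic_on_lebesgue_integral)
    show "(\<lambda>s. f (u + z) * polarized_integrand (b / 2 * (1 + \<i> * s)) (cnj b / 2 * (1 - \<i> * s)) z) holomorphic_on UNIV" for z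
      unfolding polarized_integrand_def by (intro holomorphic_intros)
    show "\<exists>D. integrable lborel D \<and> (\<forall>s z. cmod s \<le> R \<longrightarrow>
        cmod (f (u + z) * polarized_integrand (b / 2 * (1 + \<i> * s)) (cnj b / 2 * (1 - \<i> * s)) z) \<le> D z)" for R
      using polarized_dominated[of R b] by blast
  qed measurable
  then show ?thesis by (simp add: polarized_def[abs_def])
qed

lemma polarized_bounded: "\<exists>B. \<forall>u s. cmod s \<le> R \<longrightarrow> cmod (polarized b u s) \<le> B"
proof -
  obtain D where D: "integrable lborel D" "\<And>u s z. cmod s \<le> R \<Longrightarrow>
      cmod (f (u + z) * polarized_integrand (b / 2 * (1 + \<i> * s)) (cnj b / 2 * (1 - \<i> * s)) z) \<le> D z"
    using polarized_dominated[of R b] by blast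
  have "cmod (polarized b u s) \<le> (LINT z|lborel. D z)" if "cmod s \<le> R" for u s
    unfolding polarized_def
  proof (rule order_trans[OF integral_norm_bound integral_mono])
    show "integrable lborel (\<lambda>z. cmod (f (u + z) * polarized_integrand (b / 2 * (1 + \<i> * s)) (cnj b / 2 * (1 - \<i> * s)) z))"
      by (intro integrable_norm integrable_dominated[OF D(1)] D(2)[OF that]) measurable
  qed (use D that in auto)
  then show ?thesis by blast
qed

text \<open>Completing the square turns the exponent into
  \<open>(cmod a)^2 - (cmod (z - a))^2\<close>, which produces \<open>exp ((cmod a)^2)\<close>;
  \<open>fact j\<close> and \<open>pi\<close> undo the normalizations of \<open>profile\<close> and
  of the Berezin transform. The constant does not depend on \<open>u\<close>, so it is harmless as
  \<open>u\<close> tends to infinity.\<close>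

lemma polarized_real:
  fixes b :: complex and s :: real
  defines "a \<equiv> b / 2 * (1 + \<i> * complex_of_real s)"
  shows "polarized b u (of_real s) = complex_of_real (fact j * exp ((cmod a)\<^sup>2) * pi) * berezin toep (u + a)"
proof -
  have q: "cnj b / 2 * (1 - \<i> * complex_of_real s) = cnj a"
    by (simp add: a_def)
  have eq: "polarized_integrand a (cnj a) z = complex_of_real (fact j * exp ((cmod a)\<^sup>2)) * complex_of_real ((profile j (z - a))\<^sup>2)" for z
  proof -
    have "a * cnj z + cnj a * z - z * cnj z = complex_of_real ((cmod a)\<^sup>2) + complex_of_real (- (cmod (z - a))\<^sup>2)"
      by (simp add: complex_norm_square algebra_simps del: of_real_power)
    then have 1: "exp (a * cnj z + cnj a * z - z * cnj z) = complex_of_real (exp ((cmod a)\<^sup>2) * exp (- (cmod (z - a))\<^sup>2))"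
      by (simp only: exp_add exp_of_real of_real_mult)
    have "(z - a) ^ j * (cnj z - cnj a) ^ j = ((z - a) * cnj (z - a)) ^ j"
      by (simp add: power_mult_distrib)
    also have "\<dots> = complex_of_real ((cmod (z - a) ^ j)\<^sup>2)"
      by (simp only: complex_norm_square[symmetric] of_real_power[symmetric] power_mult[symmetric] mult.commute)
    finally have 2: "(z - a) ^ j * (cnj z - cnj a) ^ j = complex_of_real ((cmod (z - a) ^ j)\<^sup>2)" .
    have "(profile j (z - a))\<^sup>2 = (cmod (z - a) ^ j)\<^sup>2 / fact j * exp (- (cmod (z - a))\<^sup>2)"
      by (simp add: profile_def power_mult_distrib power_divide exp_double[symmetric])
    then have "fact j * exp ((cmod a)\<^sup>2) * (profile j (z - a))\<^sup>2 = (cmod (z - a) ^ j)\<^sup>2 * (exp ((cmod a)\<^sup>2) * exp (- (cmod (z - a))\<^sup>2))"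
      by simp
    then show ?thesis
      unfolding polarized_integrand_def 1 2 by (simp only: of_real_mult[symmetric])
  qed
  have "(LINT z|lborel. f z * complex_of_real ((profile j (z - (u + a)))\<^sup>2))
      = (LINT z|lborel. f (u + z) * complex_of_real ((profile j (u + z - (u + a)))\<^sup>2))"
    by (rule integral_lborel_translate[symmetric]) measurable
  also have "\<dots> = (LINT z|lborel. f (u + z) * complex_of_real ((profile j (z - a))\<^sup>2))"
    by simp
  finally have ber: "berezin toep (u + a) = 1 / complex_of_real pi * (LINT z|lborel. f (u + z) * complex_of_real ((profile j (z - a))\<^sup>2))"
    unfolding berezin_toep by simp
  have "polarized b u (of_real s) = (LINT z|lborel. complex_of_real (fact j * exp ((cmod a)\<^sup>2)) * (f (u + z) * complex_of_real ((profile j (z - a))\<^sup>2)))"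
    unfolding polarized_def q a_def[symmetric] eq by (simp only: mult.left_commute)
  also have "\<dots> = complex_of_real (fact j * exp ((cmod a)\<^sup>2)) * (LINT z|lborel. f (u + z) * complex_of_real ((profile j (z - a))\<^sup>2))"
    by (rule integral_mult_right_zero)
  finally show ?thesis unfolding ber by simp
qed

text \<open>Translation by \<open>u\<close> splits \<open>exp (u * cnj u + b * cnj u)\<close> off
  the integrand. Together with the Gaussian weights at \<open>u + b\<close> and \<open>u\<close> its
  modulus is \<open>exp (- (cmod b)^2 / 2)\<close>, free of \<open>u\<close>.\<close>

lemma flat_kernel_polarized:
  "flat_kernel (u + b) u = exp (- (cmod b)\<^sup>2 / 2) / fact j * cmod (polarized b u (- \<i>))"
proof -
  have eq: "f (u + z) * cnj (coherent j (u + z) u) * coherent j (u + z) (u + b)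
      = exp (u * cnj u + b * cnj u) / of_nat (fact j) * (f (u + z) * polarized_integrand b 0 z)" for z
  proof -
    have 1: "cnj (exp (u * cnj (u + z) - complex_of_real ((cmod (u + z))\<^sup>2 / 2))) *
        exp ((u + b) * cnj (u + z) - complex_of_real ((cmod (u + z))\<^sup>2 / 2))
      = exp (u * cnj u + b * cnj u) * exp (b * cnj z + 0 * z - z * cnj z)"
      unfolding exp_cnj exp_add[symmetric]
      by (simp add: complex_norm_square algebra_simps del: of_real_power)
    have 2: "complex_of_real (sqrt (fact j)) * complex_of_real (sqrt (fact j)) = of_nat (fact j)"
      by (simp flip: of_real_mult)
    have "f (u + z) * cnj (coherent j (u + z) u) * coherent j (u + z) (u + b)
        = f (u + z) * (cnj z ^ j * (z - b) ^ j) / (complex_of_real (sqrt (fact j)) * complex_of_real (sqrt (fact j))) *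
          (cnj (exp (u * cnj (u + z) - complex_of_real ((cmod (u + z))\<^sup>2 / 2))) *
            exp ((u + b) * cnj (u + z) - complex_of_real ((cmod (u + z))\<^sup>2 / 2)))"
      by (simp add: coherent_def mult_ac)
    then show ?thesis
      unfolding 1 2 by (simp add: polarized_integrand_def mult_ac)
  qed
  have s: "1 + \<i> * - \<i> = 2" "1 - \<i> * - \<i> = 0" by simp_all
  have "toep_kernel (u + b) u = (LINT z|lborel. f (u + z) * cnj (coherent j (u + z) u) * coherent j (u + z) (u + b))"
    unfolding toep_kernel_def by (rule integral_lborel_translate[symmetric]) measurable
  also have "\<dots> = exp (u * cnj u + b * cnj u) / of_nat (fact j) * (LINT z|lborel. f (u + z) * polarized_integrand b 0 z)"
    unfolding eq by (rule integral_mult_right_zero)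
  also have "(LINT z|lborel. f (u + z) * polarized_integrand b 0 z) = polarized b u (- \<i>)"
    unfolding polarized_def s by simp
  finally have k: "cmod (toep_kernel (u + b) u) = exp (Re (u * cnj u + b * cnj u)) / fact j * cmod (polarized b u (- \<i>))"
    by (simp add: norm_mult norm_divide norm_exp_eq_Re)
  have u: "Re (u * cnj u) = (cmod u)\<^sup>2" by (metis Re_complex_of_real complex_norm_square)
  have "(cmod (u + b))\<^sup>2 = (cmod u)\<^sup>2 + (cmod b)\<^sup>2 + 2 * Re (b * cnj u)"
    using cmod_diff_square[of u "- b"] by simp
  then have "Re (u * cnj u + b * cnj u) + (- (cmod (u + b))\<^sup>2 / 2) + (- (cmod u)\<^sup>2 / 2) = - (cmod b)\<^sup>2 / 2"
    unfolding plus_complex.sel u by argo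
  then have e: "exp (Re (u * cnj u + b * cnj u)) * exp (- (cmod (u + b))\<^sup>2 / 2) * exp (- (cmod u)\<^sup>2 / 2) = exp (- (cmod b)\<^sup>2 / 2)"
    by (simp only: exp_add[symmetric])
  show ?thesis
    unfolding flat_kernel_def k
    by (simp only: e[symmetric] times_divide_eq_left times_divide_eq_right mult_ac)
qed

section \<open>Column integrals at infinity\<close>

lemma column_mass_translate: "column_mass u = (\<integral>\<^sup>+b. ennreal (flat_kernel (u + b) u) \<partial>lborel)"
  unfolding column_mass_def by (rule nn_integral_lborel_translate[symmetric]) measurable

text \<open>In terms of the offset \<open>b\<close> the majorant is the autocorrelation of
  \<open>profile j\<close>, independent of \<open>u\<close>: it is the dominating function in
  \<open>column_mass_tendsto_zero\<close>.\<close>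

lemma flat_kernel_translate_le:
  "ennreal (flat_kernel (u + b) u) \<le> ennreal C * (\<integral>\<^sup>+z. ennreal (profile j z) * ennreal (profile j (z - b)) \<partial>lborel)"
proof -
  have "conv j (\<lambda>z. ennreal (profile j (z - (u + b)))) u
      = (\<integral>\<^sup>+z. ennreal (profile j (u - (u + z))) * ennreal (profile j (u + z - (u + b))) \<partial>lborel)"
    unfolding conv_def by (rule nn_integral_lborel_translate[symmetric]) measurable
  also have "\<dots> = (\<integral>\<^sup>+z. ennreal (profile j z) * ennreal (profile j (z - b)) \<partial>lborel)"
    by (simp add: profile_def)
  finally show ?thesis using flat_kernel_le[of "u + b" u] by simp
qed

lemma nn_integral_profile_correlation:
  "(\<integral>\<^sup>+b. (\<integral>\<^sup>+z. ennreal (profile j z) * ennreal (profile j (z - b)) \<partial>lborel) \<partial>lborel) = (profile_mass j)\<^sup>2"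
proof -
  have "(\<integral>\<^sup>+b. (\<integral>\<^sup>+z. ennreal (profile j z) * ennreal (profile j (z - b)) \<partial>lborel) \<partial>lborel)
      = (\<integral>\<^sup>+z. (\<integral>\<^sup>+b. ennreal (profile j z) * ennreal (profile j (z - b)) \<partial>lborel) \<partial>lborel)"
    by (rule lborel_pair.Fubini') measurable
  also have "\<dots> = (profile_mass j)\<^sup>2"
    by (simp add: nn_integral_cmult nn_integral_multc profile_mass_shift power2_eq_square flip: profile_mass_def)
  finally show ?thesis .
qed

lemma column_mass_le: "column_mass u \<le> ennreal C * (profile_mass j)\<^sup>2"
proof -
  have "column_mass u \<le> (\<integral>\<^sup>+b. ennreal C * (\<integral>\<^sup>+z. ennreal (profile j z) * ennreal (profile j (z - b)) \<partial>lborel) \<partial>lborel)"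
    unfolding column_mass_translate by (intro nn_integral_mono flat_kernel_translate_le)
  also have "\<dots> = ennreal C * (profile_mass j)\<^sup>2"
    by (subst nn_integral_cmult) (simp_all add: nn_integral_profile_correlation)
  finally show ?thesis .
qed

lemma flat_kernel_tendsto_zero:
  assumes B: "(berezin toep \<longlongrightarrow> 0) at_infinity" and u: "filterlim u at_infinity sequentially"
  shows "(\<lambda>n. flat_kernel (u n + b) (u n)) \<longlonglongrightarrow> 0"
proof -
  have "(\<lambda>n. polarized b (u n) (- \<i>)) \<longlonglongrightarrow> 0"
  proof (rule tendsto_zero_from_real_axis)
    show "\<exists>B. \<forall>n s. cmod s \<le> R \<longrightarrow> cmod (polarized b (u n) s) \<le> B" for R
      using polarized_bounded[of R b] by blast
    fix s :: real
    define a where "a = b / 2 * (1 + \<i> * complex_of_real s)"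
    have "filterlim (\<lambda>n. u n + a) at_infinity sequentially"
      using u by (rule tendsto_add_filterlim_at_infinity'[OF _ tendsto_const])
    then have "(\<lambda>n. berezin toep (u n + a)) \<longlonglongrightarrow> 0"
      by (rule filterlim_compose[OF B])
    then have "(\<lambda>n. complex_of_real (fact j * exp ((cmod a)\<^sup>2) * pi) * berezin toep (u n + a)) \<longlonglongrightarrow> 0"
      by (rule tendsto_mult_right_zero)
    then show "(\<lambda>n. polarized b (u n) (of_real s)) \<longlonglongrightarrow> 0"
      unfolding polarized_real a_def .
  qed (rule polarized_holomorphic)
  then have "(\<lambda>n. exp (- (cmod b)\<^sup>2 / 2) / fact j * cmod (polarized b (u n) (- \<i>))) \<longlonglongrightarrow> 0"
    by (intro tendsto_mult_right_zero tendsto_norm_zero)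
  then show ?thesis by (simp only: flat_kernel_polarized)
qed

lemma column_mass_tendsto_zero:
  assumes B: "(berezin toep \<longlongrightarrow> 0) at_infinity" and u: "filterlim u at_infinity sequentially"
  shows "(\<lambda>n. column_mass (u n)) \<longlonglongrightarrow> 0"
proof -
  let ?W = "\<lambda>b. ennreal C * (\<integral>\<^sup>+z. ennreal (profile j z) * ennreal (profile j (z - b)) \<partial>lborel)"
  have "(\<lambda>n. \<integral>\<^sup>+b. ennreal (flat_kernel (u n + b) (u n)) \<partial>lborel) \<longlonglongrightarrow> (\<integral>\<^sup>+b. 0 \<partial>(lborel :: complex measure))"
  proof (rule nn_integral_dominated_convergence[where w = ?W])
    have "(\<integral>\<^sup>+b. ?W b \<partial>lborel) = ennreal C * (profile_mass j)\<^sup>2"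
      by (subst nn_integral_cmult) (simp_all add: nn_integral_profile_correlation)
    also have "\<dots> < \<infinity>"
      using profile_mass_finite[of j] by (simp add: ennreal_mult_less_top power_less_top_ennreal)
    finally show "(\<integral>\<^sup>+b. ?W b \<partial>lborel) < \<infinity>" .
    have "(\<lambda>n. ennreal (flat_kernel (u n + b) (u n))) \<longlonglongrightarrow> ennreal 0" for b
      by (intro tendsto_ennrealI flat_kernel_tendsto_zero B u)
    then show "AE b in lborel. (\<lambda>n. ennreal (flat_kernel (u n + b) (u n))) \<longlonglongrightarrow> 0" by simp
    show "AE b in lborel. ennreal (flat_kernel (u n + b) (u n)) \<le> ?W b" for n
      by (intro AE_I2 flat_kernel_translate_le)
  qed measurable
  then show ?thesis by (simp add: column_mass_translate)
qed

text \<open>Dominated convergence was applied along sequences; splitting the integral in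
  \<open>toep_norm_estimate\<close> requires a uniform bound outside a disc.\<close>

lemma column_mass_small:
  assumes B: "(berezin toep \<longlongrightarrow> 0) at_infinity" and e: "e > 0"
  shows "\<exists>N. \<forall>u. cmod u \<ge> N \<longrightarrow> column_mass u < e"
proof (rule ccontr)
  assume "\<not> ?thesis"
  then have "\<forall>n::nat. \<exists>u. cmod u \<ge> real n \<and> column_mass u \<ge> e" by (auto simp: not_less)
  then obtain u where u: "\<And>n. cmod (u n) \<ge> real n" "\<And>n. column_mass (u n) \<ge> e" by metis
  have "filterlim (\<lambda>n. cmod (u n)) at_top sequentially"
    by (rule filterlim_at_top_mono[OF filterlim_real_sequentially]) (use u(1) in auto)
  then have "filterlim u at_infinity sequentially" by (rule filterlim_norm_at_top_imp_at_infinity)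
  from column_mass_tendsto_zero[OF B this]
  have "e \<le> 0" by (rule LIMSEQ_le_const) (use u(2) in auto)
  with e show False by simp
qed

end

section \<open>Compactness\<close>

text \<open>\<open>flat g a\<close> is the modulus of the inner product of \<open>g\<close> with the
  kernel at \<open>a\<close>, so this is weak convergence of the kernels to 0. Its square is bounded
  by an average of \<open>(flat g w)^2\<close> with weight \<open>profile 0 (a - w)\<close>; the
  weight is at most 1 and tends to 0 for each \<open>w\<close>, so dominated convergence
  applies.\<close>

lemma flat_tendsto_zero:
  assumes g: "g \<in> fock" and u: "filterlim u at_infinity sequentially"
  shows "(\<lambda>n. flat g (u n)) \<longlonglongrightarrow> 0"
proof -
  have [measurable]: "g \<in> borel_measurable borel" by (rule fock_measurable[OF g])
  let ?J = "\<lambda>a. \<integral>\<^sup>+w. ennreal (profile 0 (a - w)) * (ennreal (flat g w))\<^sup>2 \<partial>lborel"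
  have le: "(ennreal (flat g a))\<^sup>2 \<le> profile_mass 0 * ?J a" for a
  proof -
    have 1: "cmod (exp (- complex_of_real r)) = exp (- r)" for r
      by (simp add: norm_exp_eq_Re)
    have "flat g a = cmod (coef 0 g a)"
      unfolding coef_def fock_kernel_eq_coherent[symmetric] fock_reproducing[OF g] norm_mult 1
      by (simp add: flat_def)
    then have "ennreal (flat g a) \<le> ennreal (1 / pi) * conv 0 (\<lambda>w. ennreal (flat g w)) a"
      using coef_le_conv[OF g, of 0 a] by simp
    also have "\<dots> \<le> 1 * conv 0 (\<lambda>w. ennreal (flat g w)) a"
      using pi_gt3 by (intro mult_right_mono) auto
    finally have "(ennreal (flat g a))\<^sup>2 \<le> (conv 0 (\<lambda>w. ennreal (flat g w)) a)\<^sup>2"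
      by (intro power_mono) auto
    also have "\<dots> \<le> (\<integral>\<^sup>+w. ennreal (profile 0 (a - w)) \<partial>lborel) * ?J a"
      unfolding conv_def by (rule Cauchy_Schwarz_weighted) auto
    finally show ?thesis by (simp add: profile_mass_shift)
  qed
  have "(\<lambda>n. ?J (u n)) \<longlonglongrightarrow> (\<integral>\<^sup>+w. 0 \<partial>(lborel :: complex measure))"
  proof (rule nn_integral_dominated_convergence[where w = "\<lambda>w. (ennreal (flat g w))\<^sup>2"])
    have "(\<lambda>n. profile 0 (u n - w)) \<longlonglongrightarrow> 0" for w
    proof -
      have "filterlim (\<lambda>n. u n + - w) at_infinity sequentially"
        using u by (rule tendsto_add_filterlim_at_infinity'[OF _ tendsto_const])
      then have "filterlim (\<lambda>n. cmod (u n - w)) at_top sequentially"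
        by (simp add: filterlim_at_infinity_conv_norm_at_top)
      moreover have "((\<lambda>t::real. exp (- t\<^sup>2 / 2)) \<longlongrightarrow> 0) at_top" by real_asymp
      ultimately show ?thesis
        unfolding profile_def by (auto intro: filterlim_compose)
    qed
    then have "(\<lambda>n. ennreal (profile 0 (u n - w)) * (ennreal (flat g w))\<^sup>2) \<longlonglongrightarrow> ennreal 0" for w
      using tendsto_ennrealI[OF tendsto_mult_left_zero, of "\<lambda>n. profile 0 (u n - w)" sequentially "(flat g w)\<^sup>2"]
      by (simp add: ennreal_power ennreal_mult del: ennreal_0)
    then show "AE w in lborel. (\<lambda>n. ennreal (profile 0 (u n - w)) * (ennreal (flat g w))\<^sup>2) \<longlonglongrightarrow> 0" by simp
    show "AE w in lborel. ennreal (profile 0 (u n - w)) * (ennreal (flat g w))\<^sup>2 \<le> (ennreal (flat g w))\<^sup>2" for n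
    proof (rule AE_I2)
      fix w
      have "ennreal (profile 0 (u n - w)) \<le> 1" by (simp add: profile_def)
      from mult_right_mono[OF this, of "(ennreal (flat g w))\<^sup>2"]
      show "ennreal (profile 0 (u n - w)) * (ennreal (flat g w))\<^sup>2 \<le> (ennreal (flat g w))\<^sup>2" by simp
    qed
  qed (use flat_fock_finite[OF g] in measurable)
  then have "(\<lambda>n. profile_mass 0 * ?J (u n)) \<longlonglongrightarrow> profile_mass 0 * 0"
    using profile_mass_finite[of 0] by (intro ennreal_tendsto_cmult) auto
  then have lim0: "(\<lambda>n. profile_mass 0 * ?J (u n)) \<longlonglongrightarrow> 0" by simp
  have "(\<lambda>n. (ennreal (flat g (u n)))\<^sup>2) \<longlonglongrightarrow> 0"
    by (rule tendsto_sandwich[OF _ _ tendsto_const lim0]) (simp_all add: le)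
  then have "(\<lambda>n. ennreal ((flat g (u n))\<^sup>2)) \<longlonglongrightarrow> ennreal 0"
    by (simp add: ennreal_power)
  then have "(\<lambda>n. (flat g (u n))\<^sup>2) \<longlonglongrightarrow> 0"
    by (rule tendsto_ennrealD) auto
  then have "(\<lambda>n. sqrt ((flat g (u n))\<^sup>2)) \<longlonglongrightarrow> sqrt 0"
    by (rule tendsto_real_sqrt)
  then show ?thesis by simp
qed

section \<open>Normal families in the unit ball\<close>

text \<open>Fatou's lemma for the squares of the weighted moduli.\<close>

lemma fock_pointwise_limit:
  assumes g: "\<And>n. g n \<in> fock" "\<And>n. fock_norm (g n) \<le> 1"
    and G: "G holomorphic_on UNIV" and lim: "\<And>z. (\<lambda>n. g n z) \<longlonglongrightarrow> G z"
  shows "G \<in> fock" "fock_norm G \<le> 1"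
proof -
  have [measurable]: "g n \<in> borel_measurable borel" for n by (rule fock_measurable[OF g(1)])
  have "(\<integral>\<^sup>+w. (ennreal (flat G w))\<^sup>2 \<partial>lborel) = (\<integral>\<^sup>+w. liminf (\<lambda>n. (ennreal (flat (g n) w))\<^sup>2) \<partial>lborel)"
  proof (rule nn_integral_cong)
    fix w
    have "(\<lambda>n. ennreal ((flat (g n) w)\<^sup>2)) \<longlonglongrightarrow> ennreal ((flat G w)\<^sup>2)"
      unfolding flat_def by (intro tendsto_ennrealI tendsto_intros lim)
    then have "liminf (\<lambda>n. ennreal ((flat (g n) w)\<^sup>2)) = ennreal ((flat G w)\<^sup>2)"
      by (intro lim_imp_Liminf) auto
    then show "(ennreal (flat G w))\<^sup>2 = liminf (\<lambda>n. (ennreal (flat (g n) w))\<^sup>2)"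
      by (simp add: ennreal_power)
  qed
  also have "\<dots> \<le> liminf (\<lambda>n. \<integral>\<^sup>+w. (ennreal (flat (g n) w))\<^sup>2 \<partial>lborel)"
    by (rule nn_integral_liminf) measurable
  also have "\<dots> \<le> liminf (\<lambda>n. ennreal pi * 1)"
  proof (rule Liminf_mono, rule always_eventually, rule allI)
    fix n
    have "(fock_norm (g n))\<^sup>2 \<le> 1" using g(2)[of n] fock_norm_nonneg by (simp add: power_le_one)
    then show "(\<integral>\<^sup>+w. (ennreal (flat (g n) w))\<^sup>2 \<partial>lborel) \<le> ennreal pi * 1"
      unfolding nn_integral_flat_fock[OF g(1)] by (intro mult_left_mono) auto
  qed
  finally have le: "(\<integral>\<^sup>+w. (ennreal (flat G w))\<^sup>2 \<partial>lborel) \<le> ennreal pi"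
    by (simp add: Liminf_const)
  then show "G \<in> fock" by (intro fockI G) (auto intro: le_less_trans)
  then have "ennreal (pi * (fock_norm G)\<^sup>2) \<le> ennreal (pi * 1)"
    using le by (simp add: nn_integral_flat_fock ennreal_mult)
  then have "(fock_norm G)\<^sup>2 \<le> 1\<^sup>2" by (simp add: ennreal_le_iff)
  then show "fock_norm G \<le> 1" by (rule power2_le_imp_le) simp
qed

text \<open>On the disc of radius \<open>R\<close> the unit ball is bounded by
  \<open>exp (R^2 / 2)\<close>, hence normal. The lemma plays the part of weak sequential
  compactness of the unit ball.\<close>

lemma fock_Montel:
  assumes g: "\<And>n. g n \<in> fock" "\<And>n. fock_norm (g n) \<le> 1"
  obtains G r where "G \<in> fock" "fock_norm G \<le> 1" "strict_mono (r :: nat \<Rightarrow> nat)"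
    "\<And>z. (\<lambda>n. g (r n) z) \<longlonglongrightarrow> G z"
proof -
  have hol: "h holomorphic_on UNIV" if "h \<in> range g" for h
    using that g(1) by (auto simp: fock_def)
  have bnd: "\<exists>B. \<forall>h\<in>range g. \<forall>z\<in>K. cmod (h z) \<le> B" if K: "compact K" for K
  proof -
    obtain R where R: "\<And>z. z \<in> K \<Longrightarrow> cmod z \<le> R"
      using compact_imp_bounded[OF K] by (auto simp: bounded_iff)
    have "cmod (g n z) \<le> exp (R\<^sup>2 / 2)" if z: "z \<in> K" for n z
    proof -
      have "cmod (g n z) = flat (g n) z * exp ((cmod z)\<^sup>2 / 2)"
        by (simp add: flat_def exp_minus)
      also have "\<dots> \<le> 1 * exp (R\<^sup>2 / 2)"
        using flat_le_fock_norm[OF g(1)[of n], of z] g(2)[of n] R[OF z]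
        by (intro mult_mono) (auto intro: power_mono)
      finally show ?thesis by simp
    qed
    then show ?thesis by blast
  qed
  obtain G r where G: "G holomorphic_on UNIV" and r: "strict_mono (r :: nat \<Rightarrow> nat)"
    and lim: "\<And>z. z \<in> UNIV \<Longrightarrow> (\<lambda>n. g (r n) z) \<longlonglongrightarrow> G z"
    by (rule Montel[of UNIV "range g" g]) (use hol bnd in blast)+
  have "G \<in> fock" "fock_norm G \<le> 1"
    using fock_pointwise_limit[of "\<lambda>n. g (r n)" G] g G lim by simp_all
  then show thesis by (rule that) (use r lim in auto)
qed

context bounded_symbol
begin

text \<open>The integral in \<open>toep_norm_estimate\<close> is split at a large disc: outside it
  the column integrals are small, inside it dominated convergence applies. The bound 2 accommodates
  differences of two elements of the unit ball.\<close>

lemma toep_tendsto_zero: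
  assumes B: "(berezin toep \<longlongrightarrow> 0) at_infinity"
    and d: "\<And>n. d n \<in> fock" "\<And>n. fock_norm (d n) \<le> 2" "\<And>z. (\<lambda>n. d n z) \<longlonglongrightarrow> 0"
  shows "(\<lambda>n. fock_norm (toep (d n))) \<longlonglongrightarrow> 0"
proof -
  have [measurable]: "d n \<in> borel_measurable borel" for n by (rule fock_measurable[OF d(1)])
  let ?M = "ennreal C * (profile_mass j)\<^sup>2"
  have M: "?M < top"
    using profile_mass_finite[of j] by (simp add: ennreal_mult_less_top power_less_top_ennreal)
  define I where "I n = (\<integral>\<^sup>+u. column_mass u * (ennreal (flat (d n) u))\<^sup>2 \<partial>lborel)" for n
  have "I \<longlonglongrightarrow> 0"
  proof (rule order_tendstoI)
    fix a :: ennreal assume "0 < a"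
    \<comment> \<open>An intermediate value \<open>b\<close> is a real number even if
      \<open>a\<close> is infinite.\<close>
    then obtain b where b: "0 < b" "b < a" using dense by blast
    then obtain e where e: "b = ennreal e" "e > 0" by (cases b) auto
    \<comment> \<open>The part outside the disc is at most \<open>e' * (pi * 2^2)\<close>, by
      \<open>nn_integral_flat_fock\<close> and the norm bound 2; this equals
      \<open>e / 2\<close>.\<close>
    define e' where "e' = e / (8 * pi)"
    have e': "e' > 0" using e by (simp add: e'_def)
    obtain N where N: "\<And>u. cmod u \<ge> N \<Longrightarrow> column_mass u < ennreal e'"
      using column_mass_small[OF B, of "ennreal e'"] e' by auto
    have [measurable]: "cball (0::complex) N \<in> sets borel" by simp
    let ?L = "\<lambda>n u. column_mass u * (ennreal (flat (d n) u))\<^sup>2 * indicator (cball 0 N) u"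
    have "(\<lambda>n. \<integral>\<^sup>+u. ?L n u \<partial>lborel) \<longlonglongrightarrow> (\<integral>\<^sup>+u. 0 \<partial>(lborel :: complex measure))"
    \<comment> \<open>On the disc \<open>?M\<close> bounds the column integrals and 4 the squares of
      the weighted moduli, which are at most the norm.\<close>
    proof (rule nn_integral_dominated_convergence[where w = "\<lambda>u. ?M * ennreal 4 * indicator (cball 0 N) u"])
      have "(\<integral>\<^sup>+u. ?M * ennreal 4 * indicator (cball 0 N) u \<partial>(lborel :: complex measure)) = ?M * ennreal 4 * emeasure lborel (cball (0::complex) N)"
        by (rule nn_integral_cmult_indicator) simp
      also have "\<dots> < \<infinity>"
        using M emeasure_compact_finite[OF compact_cball[of "0::complex" N]] by (simp add: ennreal_mult_less_top del: ennreal_numeral)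
      finally show "(\<integral>\<^sup>+u. ?M * ennreal 4 * indicator (cball 0 N) u \<partial>(lborel :: complex measure)) < \<infinity>" .
      show "AE u in lborel. ?L n u \<le> ?M * ennreal 4 * indicator (cball 0 N) u" for n
      proof (rule AE_I2)
        fix u
        have "flat (d n) u \<le> 2"
          using flat_le_fock_norm[OF d(1)[of n], of u] d(2)[of n] by linarith
        then have "(flat (d n) u)\<^sup>2 \<le> 2\<^sup>2" by (intro power_mono) auto
        then have "(ennreal (flat (d n) u))\<^sup>2 \<le> ennreal 4"
          unfolding ennreal_power[OF flat_nonneg] by (intro ennreal_leI) simp
        then show "?L n u \<le> ?M * ennreal 4 * indicator (cball 0 N) u"
          by (intro mult_mono column_mass_le) auto
      qed
      have "(\<lambda>n. ?L n u) \<longlonglongrightarrow> 0" for u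
      proof -
        have "(\<lambda>n. ennreal ((flat (d n) u)\<^sup>2)) \<longlonglongrightarrow> ennreal ((cmod 0 * exp (- (cmod u)\<^sup>2 / 2))\<^sup>2)"
          unfolding flat_def by (intro tendsto_ennrealI tendsto_intros d(3))
        then have "(\<lambda>n. (column_mass u * indicator (cball 0 N) u) * (ennreal (flat (d n) u))\<^sup>2) \<longlonglongrightarrow> (column_mass u * indicator (cball 0 N) u) * 0"
          using M column_mass_le[of u]
          by (intro ennreal_tendsto_cmult) (auto simp: ennreal_power indicator_def intro: le_less_trans)
        then show ?thesis by (simp add: mult_ac)
      qed
      then show "AE u in lborel. (\<lambda>n. ?L n u) \<longlonglongrightarrow> 0" by simp
    qed measurable
    then have "(\<lambda>n. \<integral>\<^sup>+u. ?L n u \<partial>lborel) \<longlonglongrightarrow> 0" by simp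
    then have ev: "\<forall>\<^sub>F n in sequentially. (\<integral>\<^sup>+u. ?L n u \<partial>lborel) < ennreal (e / 2)"
      by (rule order_tendstoD(2)) (use e in simp)
    have le: "I n \<le> (\<integral>\<^sup>+u. ?L n u \<partial>lborel) + ennreal (e / 2)" for n
    proof -
      have "I n \<le> (\<integral>\<^sup>+u. ?L n u + ennreal e' * (ennreal (flat (d n) u))\<^sup>2 \<partial>lborel)"
        unfolding I_def
      proof (rule nn_integral_mono)
        fix u
        show "column_mass u * (ennreal (flat (d n) u))\<^sup>2 \<le> ?L n u + ennreal e' * (ennreal (flat (d n) u))\<^sup>2"
        proof (cases "u \<in> cball 0 N")
          case False
          then have "column_mass u \<le> ennreal e'" using N[of u] by (simp add: less_imp_le)
          then have "column_mass u * (ennreal (flat (d n) u))\<^sup>2 \<le> ennreal e' * (ennreal (flat (d n) u))\<^sup>2"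
            by (rule mult_right_mono) simp
          then show ?thesis by (rule order_trans) simp
        qed simp
      qed
      also have "\<dots> = (\<integral>\<^sup>+u. ?L n u \<partial>lborel) + ennreal e' * (\<integral>\<^sup>+u. (ennreal (flat (d n) u))\<^sup>2 \<partial>lborel)"
        by (simp add: nn_integral_add nn_integral_cmult)
      also have "\<dots> \<le> (\<integral>\<^sup>+u. ?L n u \<partial>lborel) + ennreal (e / 2)"
      proof (rule add_left_mono)
        have "(fock_norm (d n))\<^sup>2 \<le> 2\<^sup>2" by (intro power_mono d(2) fock_norm_nonneg)
        then have "e' * (pi * (fock_norm (d n))\<^sup>2) \<le> e' * (pi * 4)"
          using e' by (intro mult_left_mono) auto
        also have "\<dots> = e / 2" by (simp add: e'_def)
        finally show "ennreal e' * (\<integral>\<^sup>+u. (ennreal (flat (d n) u))\<^sup>2 \<partial>lborel) \<le> ennreal (e / 2)"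
          unfolding nn_integral_flat_fock[OF d(1)] using e' by (simp add: ennreal_leI flip: ennreal_mult)
      qed
      finally show ?thesis .
    qed
    have half: "ennreal (e / 2) + ennreal (e / 2) = b"
      using e by (simp flip: ennreal_plus)
    show "\<forall>\<^sub>F n in sequentially. I n < a"
      using ev
    proof eventually_elim
      case (elim n)
      have "I n \<le> ennreal (e / 2) + ennreal (e / 2)"
        using le[of n] elim by (meson add_right_mono less_imp_le order_trans)
      with half b show ?case by simp
    qed
  qed simp
  then have "(\<lambda>n. ?M * I n) \<longlonglongrightarrow> ?M * 0" by (rule ennreal_tendsto_cmult[OF M])
  then have lim0: "(\<lambda>n. ?M * I n) \<longlonglongrightarrow> 0" by simp
  have "(\<lambda>n. ennreal ((fock_norm (toep (d n)))\<^sup>2)) \<longlonglongrightarrow> 0"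
    by (rule tendsto_sandwich[OF _ _ tendsto_const lim0]) (simp_all add: I_def toep_norm_estimate d)
  then have "(\<lambda>n. ennreal ((fock_norm (toep (d n)))\<^sup>2)) \<longlonglongrightarrow> ennreal 0" by simp
  then have "(\<lambda>n. (fock_norm (toep (d n)))\<^sup>2) \<longlonglongrightarrow> 0"
    by (rule tendsto_ennrealD) auto
  then have "(\<lambda>n. sqrt ((fock_norm (toep (d n)))\<^sup>2)) \<longlonglongrightarrow> sqrt 0"
    by (rule tendsto_real_sqrt)
  then show ?thesis by (simp add: fock_norm_nonneg)
qed

lemma toep_diff:
  assumes "g \<in> fock" "h \<in> fock"
  shows "toep (\<lambda>w. g w - h w) = (\<lambda>w. toep g w - toep h w)"
proof -
  have add: "toep (\<lambda>w. g w + h w) = (\<lambda>w. toep g w + toep h w)" if "g \<in> fock" "h \<in> fock" for g h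
    using fock_linear_toep that by (simp add: fock_linear_def)
  have cmult: "toep (\<lambda>w. c * h w) = (\<lambda>w. c * toep h w)" if "h \<in> fock" for c h
    using fock_linear_toep that by (simp add: fock_linear_def)
  have "toep (\<lambda>w. g w + (-1) * h w) = (\<lambda>w. toep g w + toep (\<lambda>w. (-1) * h w) w)"
    by (rule add[OF assms(1) fock_cmult[OF assms(2)]])
  also have "toep (\<lambda>w. (-1) * h w) = (\<lambda>w. (-1) * toep h w)"
    by (rule cmult[OF assms(2)])
  finally show ?thesis by simp
qed

section \<open>The two implications\<close>

text \<open>Compactness of the closure is tested by Bolzano-Weierstrass: the accumulation point of
  an infinite set of images is the image of a Montel limit of preimages.\<close>

lemma compact_if_berezin_vanishes:
  assumes B: "(berezin toep \<longlongrightarrow> 0) at_infinity"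
  shows "fock_compact_operator toep"
proof -
  interpret M: Metric_space fock fock_dist by (rule Metric_space_fock)
  let ?S = "toep ` {g \<in> fock. fock_norm g \<le> 1}"
  have "M.mtopology derived_set_of T \<noteq> {}" if T: "infinite T" "T \<subseteq> ?S" for T
  proof -
    obtain \<sigma> :: "nat \<Rightarrow> complex \<Rightarrow> complex" where \<sigma>: "inj \<sigma>" "range \<sigma> \<subseteq> T"
      using infinite_countable_subset[OF T(1)] by blast
    then have "\<forall>n. \<exists>g. g \<in> fock \<and> fock_norm g \<le> 1 \<and> \<sigma> n = toep g" using T(2) by blast
    then obtain g where g: "\<And>n. g n \<in> fock" "\<And>n. fock_norm (g n) \<le> 1" "\<And>n. \<sigma> n = toep (g n)" by metis
    obtain G r where G: "G \<in> fock" "fock_norm G \<le> 1" and r: "strict_mono (r :: nat \<Rightarrow> nat)"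
      and lim: "\<And>z. (\<lambda>n. g (r n) z) \<longlonglongrightarrow> G z"
      using fock_Montel[of g] g(1,2) by blast
    have conv: "(\<lambda>n. fock_dist (toep G) (\<sigma> (r n))) \<longlonglongrightarrow> 0"
    proof -
      let ?d = "\<lambda>n w. G w - g (r n) w"
      have "fock_norm (?d n) \<le> 2" for n
      proof -
        have "fock_norm (\<lambda>w. G w + (-1) * g (r n) w) \<le> fock_norm G + fock_norm (\<lambda>w. (-1) * g (r n) w)"
          by (intro fock_norm_triangle fock_cmult G g)
        also have "fock_norm (\<lambda>w. (-1) * g (r n) w) = fock_norm (g (r n))"
          by (simp add: fock_norm_eq)
        finally show ?thesis using G(2) g(2)[of "r n"] by simp
      qed
      moreover have "(\<lambda>n. ?d n z) \<longlonglongrightarrow> 0" for z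
        using tendsto_diff[OF tendsto_const lim, of "G z" z] by simp
      ultimately have "(\<lambda>n. fock_norm (toep (?d n))) \<longlonglongrightarrow> 0"
        by (intro toep_tendsto_zero B fock_diff G g)
      then show ?thesis
        by (simp add: fock_dist_def toep_diff G g)
    qed
    have "toep G \<in> M.mtopology derived_set_of T"
      unfolding M.metric_derived_set_of
    proof (intro CollectI conjI allI impI)
      show "toep G \<in> fock" by (rule toep_in_fock[OF G(1)])
      fix e :: real assume "e > 0"
      then have "\<forall>\<^sub>F n in sequentially. fock_dist (toep G) (\<sigma> (r n)) < e"
        using conv by (rule order_tendstoD(2)[rotated])
      then obtain n0 where n0: "\<And>n. n \<ge> n0 \<Longrightarrow> fock_dist (toep G) (\<sigma> (r n)) < e"
        by (auto simp: eventually_sequentially)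
      have "\<sigma> (r n0) \<noteq> \<sigma> (r (Suc n0))"
        using \<sigma>(1) strict_monoD[OF r, of n0 "Suc n0"] by (auto dest: injD)
      \<comment> \<open>\<open>\<sigma> \<circ> r\<close> is injective, so of two consecutive terms
        at most one is \<open>toep G\<close>; an accumulation point requires points of
        \<open>T\<close> different from itself.\<close>
      then obtain n where n: "n \<ge> n0" "\<sigma> (r n) \<noteq> toep G"
        by (metis order_refl le_Suc_eq)
      show "\<exists>y\<in>T. y \<noteq> toep G \<and> y \<in> M.mball (toep G) e"
      proof (intro bexI[of _ "\<sigma> (r n)"] conjI)
        show "\<sigma> (r n) \<in> M.mball (toep G) e"
          using n0[OF n(1)] toep_in_fock g G by (simp add: g(3))
      qed (use n \<sigma> in auto)
    qed
    then show ?thesis by blast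
  qed
  then have "compactin M.mtopology (M.mtopology closure_of ?S)"
    unfolding M.compact_closure_of_eq_Bolzano_Weierstrass by blast
  then show ?thesis
    using fock_linear_toep by (simp add: fock_compact_operator_def Let_def)
qed

lemma berezin_vanishes_if_compact:
  assumes "fock_compact_operator toep"
  shows "(berezin toep \<longlongrightarrow> 0) at_infinity"
proof (rule ccontr)
  interpret M: Metric_space fock fock_dist by (rule Metric_space_fock)
  let ?S = "toep ` {g \<in> fock. fock_norm g \<le> 1}"
  have S: "?S \<subseteq> fock" using toep_in_fock by auto
  have comp: "compactin M.mtopology (M.mtopology closure_of ?S)"
    using assms by (simp add: fock_compact_operator_def Let_def)
  assume "\<not> (berezin toep \<longlongrightarrow> 0) at_infinity"
  then obtain e where e: "e > 0" "\<And>b. \<exists>x. cmod x \<ge> b \<and> cmod (berezin toep x) \<ge> e"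
    unfolding Lim_at_infinity by (auto simp: not_less)
  then have "\<forall>n::nat. \<exists>x. cmod x \<ge> real n \<and> cmod (berezin toep x) \<ge> e" by blast
  then obtain u where u: "\<And>n. cmod (u n) \<ge> real n" "\<And>n. cmod (berezin toep (u n)) \<ge> e" by metis
  have "filterlim (\<lambda>n. cmod (u n)) at_top sequentially"
    by (rule filterlim_at_top_mono[OF filterlim_real_sequentially]) (use u(1) in auto)
  then have uinf: "filterlim u at_infinity sequentially" by (rule filterlim_norm_at_top_imp_at_infinity)
  have "range (\<lambda>n. toep (fock_kernel (u n))) \<subseteq> ?S"
    using fock_kernel_in_fock fock_norm_kernel by auto
  also have "?S \<subseteq> M.mtopology closure_of ?S"
    using S by (intro closure_of_subset) simp
  finally have "range (\<lambda>n. toep (fock_kernel (u n))) \<subseteq> M.mtopology closure_of ?S" .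
  then obtain l r where r: "strict_mono (r :: nat \<Rightarrow> nat)"
    and l: "limitin M.mtopology ((\<lambda>n. toep (fock_kernel (u n))) \<circ> r) l sequentially"
    using comp unfolding M.compactin_sequentially by blast
  have lf: "l \<in> fock" using l by (simp add: M.limitin_metric)
  have ur: "filterlim (\<lambda>n. u (r n)) at_infinity sequentially"
    using filterlim_compose[OF uinf filterlim_subseq[OF r]] .
  have small: "(\<lambda>n. flat l (u (r n))) \<longlonglongrightarrow> 0" by (rule flat_tendsto_zero[OF lf ur])
  have "\<forall>\<^sub>F n in sequentially. fock_dist (toep (fock_kernel (u (r n)))) l < e / 2"
    using l e(1) unfolding M.limitin_metric
    by (auto simp: o_def elim!: eventually_mono dest!: spec[of _ "e / 2"])
  moreover have "\<forall>\<^sub>F n in sequentially. flat l (u (r n)) < e / 2"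
    using order_tendstoD(2)[OF small, of "e / 2"] e(1) by simp
  ultimately have "\<forall>\<^sub>F n in sequentially. False"
  proof eventually_elim
    case (elim n)
    let ?k = "fock_kernel (u (r n))"
    have k: "?k \<in> fock" by (rule fock_kernel_in_fock)
    have Tk: "toep ?k \<in> fock" by (rule toep_in_fock[OF k])
    \<comment> \<open>The limit \<open>l\<close> is split off. The first term is at most the
      distance to \<open>l\<close>, since kernels have norm 1, and the second has modulus
      \<open>flat l (u (r n))\<close>. Both are below \<open>e / 2\<close>, against the choice of
      \<open>u\<close>.\<close>
    have "berezin toep (u (r n)) = fock_inner (\<lambda>w. toep ?k w - l w) ?k + fock_inner l ?k"
      by (simp add: berezin_def fock_inner_diff_left Tk lf k)
    then have "cmod (berezin toep (u (r n))) \<le> cmod (fock_inner (\<lambda>w. toep ?k w - l w) ?k) + cmod (fock_inner l ?k)"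
      by (simp add: norm_triangle_ineq)
    moreover have "cmod (fock_inner (\<lambda>w. toep ?k w - l w) ?k) \<le> fock_dist (toep ?k) l"
      using fock_Cauchy_Schwarz(2)[OF fock_diff[OF Tk lf] k] by (simp add: fock_dist_def fock_norm_kernel)
    moreover have "cmod (fock_inner l ?k) = flat l (u (r n))"
    proof -
      have 1: "cmod (exp (- complex_of_real r)) = exp (- r)" for r
        by (simp add: norm_exp_eq_Re)
      show ?thesis unfolding fock_reproducing[OF lf] norm_mult 1 by (simp add: flat_def)
    qed
    ultimately show False using elim u(2)[of "r n"] by linarith
  qed
  then show False by simp
qed

text \<open>Supplies the continuity in \<open>C0\<close>: along a convergent sequence the centres
  stay in a disc, where the translates of \<open>profile j\<close> have a common Gaussian
  majorant.\<close>

lemma berezin_continuous: "continuous_on UNIV (berezin toep)"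
  unfolding continuous_on_sequentially
proof (intro allI ballI impI, elim conjE)
  fix X :: "nat \<Rightarrow> complex" and a assume X: "X \<longlonglongrightarrow> a"
  obtain R where R': "0 < R" "\<forall>n. cmod (X n) \<le> R"
    by (rule BseqE[OF convergent_imp_Bseq[OF convergentI[OF X]]])
  then have R: "\<And>n. cmod (X n) \<le> R" "R > 0" by blast+
  obtain K where K: "K \<ge> 0" "\<And>z w. cmod w \<le> R \<Longrightarrow> profile j (z - w) \<le> K * exp (- (1 / 4) * (cmod z)\<^sup>2)"
    using profile_dominated[of R j] R(2) by auto
  have "(\<lambda>n. LINT z|lborel. f z * complex_of_real ((profile j (z - X n))\<^sup>2)) \<longlonglongrightarrow> (LINT z|lborel. f z * complex_of_real ((profile j (z - a))\<^sup>2))"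
  proof (rule integral_dominated_convergence[where w = "\<lambda>z. C * (K\<^sup>2 * exp (- (1 / 2) * (cmod z)\<^sup>2))"])
    show "integrable lborel (\<lambda>z::complex. C * (K\<^sup>2 * exp (- (1 / 2) * (cmod z)\<^sup>2)))"
      by (intro integrable_mult_right integrable_gaussian) simp
    have "(\<lambda>n. f z * complex_of_real ((profile j (z - X n))\<^sup>2)) \<longlonglongrightarrow> f z * complex_of_real ((profile j (z - a))\<^sup>2)" for z
      unfolding profile_def by (intro tendsto_intros X) auto
    then show "AE z in lborel. (\<lambda>n. f z * complex_of_real ((profile j (z - X n))\<^sup>2)) \<longlonglongrightarrow> f z * complex_of_real ((profile j (z - a))\<^sup>2)"
      by simp
    show "AE z in lborel. cmod (f z * complex_of_real ((profile j (z - X n))\<^sup>2)) \<le> C * (K\<^sup>2 * exp (- (1 / 2) * (cmod z)\<^sup>2))" for n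
    proof (rule AE_I2)
      fix z
      have "(profile j (z - X n))\<^sup>2 \<le> (K * exp (- (1 / 4) * (cmod z)\<^sup>2))\<^sup>2"
        by (intro power_mono K R) simp
      also have "\<dots> = K\<^sup>2 * exp (- (1 / 2) * (cmod z)\<^sup>2)"
        by (simp add: power_mult_distrib exp_double[symmetric])
      finally have "cmod (complex_of_real ((profile j (z - X n))\<^sup>2)) \<le> K\<^sup>2 * exp (- (1 / 2) * (cmod z)\<^sup>2)"
        by (simp add: norm_power)
      then show "cmod (f z * complex_of_real ((profile j (z - X n))\<^sup>2)) \<le> C * (K\<^sup>2 * exp (- (1 / 2) * (cmod z)\<^sup>2))"
        unfolding norm_mult by (intro mult_mono f_bounded C_nonneg norm_ge_zero)
    qed
  qed measurable
  then show "(berezin toep \<circ> X) \<longlonglongrightarrow> berezin toep a"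
    unfolding o_def berezin_toep by (rule tendsto_mult_left)
qed

lemma compact_iff_berezin: "fock_compact_operator toep \<longleftrightarrow> berezin toep \<in> C0"
  using compact_if_berezin_vanishes berezin_vanishes_if_compact berezin_continuous
  by (auto simp: C0_def)

end

section \<open>Essentially bounded symbols and the weak definition\<close>

lemma Linfty_borel_representative:
  assumes "f \<in> Linfty"
  obtains f' C where "f' \<in> borel_measurable borel" "\<And>z. cmod (f' z) \<le> C" "AE z in lebesgue. f z = f' z"
proof -
  have f [measurable]: "f \<in> borel_measurable lebesgue" using assms by (simp add: Linfty_def)
  obtain C where C: "AE z in lebesgue. cmod (f z) \<le> C" using assms by (auto simp: Linfty_def)
  obtain R where R [measurable]: "R \<in> borel_measurable lborel" and aeR: "AE z in lborel. Re (f z) = R z"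
    using completion_ex_borel_measurable_real[of "\<lambda>z. Re (f z)" lborel] by auto
  obtain I where I [measurable]: "I \<in> borel_measurable lborel" and aeI: "AE z in lborel. Im (f z) = I z"
    using completion_ex_borel_measurable_real[of "\<lambda>z. Im (f z)" lborel] by auto
  define f0 where "f0 z = complex_of_real (R z) + \<i> * complex_of_real (I z)" for z
  \<comment> \<open>Truncation changes \<open>f0\<close> on a null set only and makes the bound hold
    everywhere; the absolute value keeps it valid at the points where \<open>f'\<close> is set to
    0.\<close>
  define f' where "f' z = (if cmod (f0 z) \<le> \<bar>C\<bar> then f0 z else 0)" for z
  have [measurable]: "f0 \<in> borel_measurable borel"
    using R I unfolding f0_def by simp
  show thesis
  proof (rule that)
    show "f' \<in> borel_measurable borel" unfolding f'_def by measurable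
    show "cmod (f' z) \<le> \<bar>C\<bar>" for z by (simp add: f'_def)
    show "AE z in lebesgue. f z = f' z"
      using C AE_completion[OF aeR] AE_completion[OF aeI]
    proof eventually_elim
      case (elim z)
      then have "f0 z = f z" by (simp add: f0_def complex_eq_iff)
      with elim show ?case by (simp add: f'_def)
    qed
  qed
qed

text \<open>The definite description is resolved by \<open>fock_inner_toep\<close> for existence and
  \<open>fock_eqI\<close> for uniqueness. Passing from \<open>f\<close> to \<open>f'\<close> does
  not change the Lebesgue integrals, and for Borel integrands these agree with those over
  \<open>lborel\<close>.\<close>

lemma toeplitz_eq_toep:
  assumes f: "f \<in> Linfty" and "bounded_symbol f' C" and ae: "AE z in lebesgue. f z = f' z" and g: "g \<in> fock"
  shows "toeplitz f j g = bounded_symbol.toep f' j g"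
proof -
  interpret bounded_symbol f' C j by fact
  have [measurable]: "f \<in> borel_measurable lebesgue" using f by (simp add: Linfty_def)
  have eq: "(LINT z|lebesgue. f z * fock_inner (fock_U z g) (fock_basis j) * fock_inner (fock_basis j) (fock_U z h))
      = (LINT z|lborel. f' z * coef j g z * cnj (coef j h z))" if h: "h \<in> fock" for h
  proof -
    have [measurable]: "coef j g \<in> borel_measurable borel" "coef j h \<in> borel_measurable borel"
      by (intro borel_measurable_coef g h)+
    have m: "(\<lambda>z. coef j g z * cnj (coef j h z)) \<in> borel_measurable lborel"
      "(\<lambda>z. f' z * (coef j g z * cnj (coef j h z))) \<in> borel_measurable lborel"
      by measurable
    have [measurable]: "(\<lambda>z. coef j g z * cnj (coef j h z)) \<in> borel_measurable lebesgue"
      "(\<lambda>z. f' z * (coef j g z * cnj (coef j h z))) \<in> borel_measurable lebesgue"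
      by (intro measurable_completion m)+
    have "f z * fock_inner (fock_U z g) (fock_basis j) * fock_inner (fock_basis j) (fock_U z h)
        = f z * (coef j g z * cnj (coef j h z))" for z
      by (simp add: fock_inner_fock_U_basis g h coef_def fock_inner_cnj[of "fock_basis j" "fock_U z h"])
    then have "(LINT z|lebesgue. f z * fock_inner (fock_U z g) (fock_basis j) * fock_inner (fock_basis j) (fock_U z h))
        = (LINT z|lebesgue. f z * (coef j g z * cnj (coef j h z)))" by (simp only:)
    also have "\<dots> = (LINT z|lebesgue. f' z * (coef j g z * cnj (coef j h z)))"
      by (rule integral_cong_AE) (use ae in \<open>auto elim: eventually_mono\<close>)
    also have "\<dots> = (LINT z|lborel. f' z * (coef j g z * cnj (coef j h z)))"
      by (rule integral_completion[OF m(2)])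
    finally show ?thesis by (simp only: mult.assoc)
  qed
  show ?thesis
    unfolding toeplitz_def
  proof (rule the_equality)
    show "toep g \<in> fock \<and> (\<forall>h\<in>fock. fock_inner (toep g) h = 1 / complex_of_real pi *
        (LINT z|lebesgue. f z * fock_inner (fock_U z g) (fock_basis j) * fock_inner (fock_basis j) (fock_U z h)))"
      by (simp add: toep_in_fock g eq fock_inner_toep)
    fix u assume "u \<in> fock \<and> (\<forall>h\<in>fock. fock_inner u h = 1 / complex_of_real pi *
        (LINT z|lebesgue. f z * fock_inner (fock_U z g) (fock_basis j) * fock_inner (fock_basis j) (fock_U z h)))"
    then show "u = toep g"
      by (intro fock_eqI toep_in_fock g) (simp_all add: eq fock_inner_toep g)
  qed
qed

text \<open>Needed because \<open>toeplitz f j\<close> is identified with \<open>toep\<close> on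
  \<open>fock\<close>, not as a map on all functions.\<close>

lemma fock_compact_operator_cong:
  assumes eq: "\<And>g. g \<in> fock \<Longrightarrow> S g = T g"
  shows "fock_compact_operator S \<longleftrightarrow> fock_compact_operator T"
proof -
  have "fock_linear S \<longleftrightarrow> fock_linear T"
    unfolding fock_linear_def by (simp add: eq fock_add fock_cmult cong: ball_cong)
  moreover have "S ` {g \<in> fock. fock_norm g \<le> 1} = T ` {g \<in> fock. fock_norm g \<le> 1}"
    by (rule image_cong) (auto simp: eq)
  ultimately show ?thesis by (simp add: fock_compact_operator_def)
qed

theorem proposition3p31:
  fixes f :: "complex \<Rightarrow> complex" and j :: nat
  assumes "f \<in> Linfty"
  shows "fock_compact_operator (toeplitz f j) \<longleftrightarrow> berezin (toeplitz f j) \<in> C0"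
proof -
  obtain f' C where f': "f' \<in> borel_measurable borel" "\<And>z. cmod (f' z) \<le> C" and ae: "AE z in lebesgue. f z = f' z"
    using Linfty_borel_representative[OF assms] by blast
  interpret bounded_symbol f' C j using f' by unfold_locales
  have eq: "toeplitz f j g = toep g" if "g \<in> fock" for g
    by (rule toeplitz_eq_toep[OF assms _ ae that]) unfold_locales
  have "berezin (toeplitz f j) = berezin toep"
    by (simp add: berezin_def fun_eq_iff eq fock_kernel_in_fock)
  then show ?thesis
    using compact_iff_berezin fock_compact_operator_cong[OF eq] by simp
qed

end
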